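(* Let $R$ be a ring, let $X$ be an $n\times m$ matrix and $Y$ an $m\times n$ matrix with entries in $R$. Suppose that $$[X_{ij},Y_{k\ell}] = -A_{i\ell}B_{kj}\qquad\text{for all } i,j,k,\ell,$$ where $A$ is an $n\times n$ matrix and $B$ is an $m\times m$ matrix whose entries commute with everything. (a) If $X$ is row-pseudo-commutative and $$[X_{ij},A_{k\ell}]-[X_{kj},A_{i\ell}]=0\qquad\text{for all } i,j,k,\ell,$$ then $$\sum_{L\subseteq[m],\,|L|=n}\operatorname{col-det}X_{[n],L}\ \operatorname{col-det}Y_{L,[n]}=\langle 0|\operatorname{col-det}\big[\,a\,A+X(1-a^\dagger B)^{-1}Y\,\big]|0\rangle .$$ (b) If $Y$ is column-pseudo-commutative and $$[Y_{ij},A_{k\ell}]-[Y_{i\ell},A_{kj}]=0\qquad\text{for all } i,j,k,\ell,$$ then $$\sum_{L\subseteq[m],\,|L|=n}\operatorname{row-det}X_{[n],L}\ \operatorname{row-det}Y_{L,[n]}=\langle 0|\operatorname{row-det}\big[\,a^\dagger A+X(1-a B)^{-1}Y\,\big]|0\rangle .$$ (c) In particular, if $[X_{ji},X_{\ell k}]=0$ and $[Y_{ij},Y_{k\ell}]=0$ whenever $j\neq\ell$, then $$\sum_{L\subseteq[m],\,|L|=n}\det X_{[n],L}\,\det Y_{L,[n]}=\langle 0|\operatorname{col-det}\big[a A+X(1-a^\dagger B)^{-1}Y\big]|0\rangle=\langle 0|\operatorname{row-det}\big[a^\dagger A+X(1-aB)^{-1}Y\big]|0\rangle .$$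
   Context: Rings are not necessarily commutative; $[x,y]=xy-yx$; $[n]=\{1,\dots,n\}$. The matrices $A$ and $B$ have entries in $R$. For an $n\times n$ matrix $M$ over a noncommutative ring, with ordered products, $$\operatorname{col-det}M=\sum_{\sigma\in S_n}\operatorname{sgn}(\sigma)M_{\sigma(1)1}M_{\sigma(2)2}\cdots M_{\sigma(n)n},\qquad \operatorname{row-det}M=\sum_{\sigma\in S_n}\operatorname{sgn}(\sigma)M_{1\sigma(1)}M_{2\sigma(2)}\cdots M_{n\sigma(n)}.$$ $X_{[n],L}$ is the submatrix of $X$ with columns in $L$ (in increasing order); $Y_{L,[n]}$ is the submatrix of $Y$ with rows in $L$ (in increasing order). In part (c) entries of $X$ in different rows commute and entries of $Y$ in different columns commute, so the factors in each term of the determinants commute and $\det$ is unambiguous. A matrix $M$ is column-pseudo-commutative if $[M_{ij},M_{k\ell}]=[M_{i\ell},M_{kj}]$ for all $i,j,k,\ell$ and $[M_{ij},M_{i\ell}]=0$ for all $i,j,\ell$. It is row-pseudo-commutative if its transpose is column-pseudo-commutative, i.e. $[M_{ij},M_{k\ell}]=[M_{kj},M_{i\ell}]$ for all $i,j,k,\ell$ and $[M_{ij},M_{kj}]=0$ for all $i,j,k$. Quantum oscillator: $a,a^\dagger$ satisfy $[a,a^\dagger]=1$, commute with all elements of $R$, and $a|0\rangle=0$, $\langle 0|a^\dagger=0$, $\langle0|0\rangle=1$. Concretely, for a word $w$ in $a,a^\dagger$, $\langle 0|w|0\rangle$ is the integer obtained by letting $a$ act as $d/dx$ and $a^\dagger$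 as multiplication by $x$ on $\mathbb{Z}[x]$, applying $w$ to $1$ and taking the constant term; $\langle0|\cdot|0\rangle$ is extended $R$-linearly to (formal, possibly infinite) sums of words with coefficients in $R$. Here $(1-a^\dagger B)^{-1}=\sum_{\nu\ge0}(a^\dagger)^\nu B^\nu$ and $(1-aB)^{-1}=\sum_{\nu\ge0}a^\nu B^\nu$ are formal geometric series; after expanding the determinants only finitely many words have nonzero expectation.
   Formalization: In (c) the conditions [X_ij,A_kl]-[X_kj,A_il]=0 of (a) and [Y_ij,A_kl]-[Y_il,A_kj]=0 of (b) are kept as hypotheses; with only the commutation of X and of Y assumed, (c) fails over rings with zero divisors. *)

theory Defs
  imports
    "Jordan_Normal_Form.DL_Submatrix"
    "HOL-Combinatorics.Permutations"
    "HOL-Computational_Algebra.Polynomial"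
    "HOL-Computational_Algebra.Formal_Power_Series"
begin

section \<open>Determinants over a noncommutative ring\<close>

text \<open>Rows and columns are indexed from 0, so \<open>{0..<n}\<close> plays the role of \<open>[n]\<close>.\<close>

definition commutator :: "'a::ring \<Rightarrow> 'a \<Rightarrow> 'a" where
  "commutator x y = x * y - y * x"

definition col_det :: "'a::ring_1 mat \<Rightarrow> 'a" where
  "col_det M = (\<Sum>\<sigma> | \<sigma> permutes {0..<dim_col M}.
     of_int (sign \<sigma>) * prod_list (map (\<lambda>j. M $$ (\<sigma> j, j)) [0..<dim_col M]))"

definition row_det :: "'a::ring_1 mat \<Rightarrow> 'a" where
  "row_det M = (\<Sum>\<sigma> | \<sigma> permutes {0..<dim_row M}.
     of_int (sign \<sigma>) * prod_list (map (\<lambda>i. M $$ (i, \<sigma> i)) [0..<dim_row M]))"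

text \<open>The determinant with no order of the factors prescribed. It is meaningful only if the
  factors of each term commute with each other: then the fold does not depend on the order in
  which the rows are visited, see \<open>unordered_det_eq\<close> below.\<close>

definition unordered_det :: "'a::ring_1 mat \<Rightarrow> 'a" where
  "unordered_det M = (\<Sum>\<sigma> | \<sigma> permutes {0..<dim_row M}.
     of_int (sign \<sigma>) * Finite_Set.fold (\<lambda>i p. M $$ (i, \<sigma> i) * p) 1 {0..<dim_row M})"

definition column_pseudo_commutative :: "'a::ring mat \<Rightarrow> bool" where
  "column_pseudo_commutative M \<longleftrightarrow>
     (\<forall>i<dim_row M. \<forall>j<dim_col M. \<forall>k<dim_row M. \<forall>l<dim_col M.
        commutator (M $$ (i,j)) (M $$ (k,l)) = commutator (M $$ (i,l)) (M $$ (k,j))) \<and>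
     (\<forall>i<dim_row M. \<forall>j<dim_col M. \<forall>l<dim_col M.
        commutator (M $$ (i,j)) (M $$ (i,l)) = 0)"

definition row_pseudo_commutative :: "'a::ring mat \<Rightarrow> bool" where
  "row_pseudo_commutative M \<longleftrightarrow> column_pseudo_commutative (transpose_mat M)"

lemma fold_mult_eq_prod_list:
  fixes g :: "'b \<Rightarrow> 'a::monoid_mult"
  assumes "\<And>x y. x \<in> set xs \<Longrightarrow> y \<in> set xs \<Longrightarrow> g x * g y = g y * g x" and "distinct xs"
  shows "Finite_Set.fold (\<lambda>x p. g x * p) 1 (set xs) = prod_list (map g xs)"
  using assms
proof (induction xs)
  case Nil
  then show ?case by simp
next
  case (Cons x xs)
  interpret comp_fun_commute_on "set (x # xs)" "\<lambda>x p. g x * p"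
    using Cons.prems(1) by unfold_locales (auto simp: fun_eq_iff mult.assoc [symmetric])
  show ?case
    using Cons by (simp add: fold_insert)
qed

lemma unordered_det_eq:
  fixes M :: "'a::ring_1 mat"
  assumes M: "M \<in> carrier_mat n n"
    and comm: "\<And>i j k l. i < n \<Longrightarrow> j < n \<Longrightarrow> k < n \<Longrightarrow> l < n \<Longrightarrow> i \<noteq> k \<Longrightarrow> j \<noteq> l \<Longrightarrow>
      commutator (M $$ (i,j)) (M $$ (k,l)) = 0"
  shows "unordered_det M = row_det M" and "unordered_det M = col_det M"
proof -
  have *: "Finite_Set.fold (\<lambda>i p. M $$ (i, \<sigma> i) * p) 1 {0..<n} = prod_list (map (\<lambda>i. M $$ (i, \<sigma> i)) xs)"
    if \<sigma>: "\<sigma> permutes {0..<n}" and xs: "distinct xs" "set xs = {0..<n}" for \<sigma> xs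
  proof -
    have "M $$ (i, \<sigma> i) * M $$ (k, \<sigma> k) = M $$ (k, \<sigma> k) * M $$ (i, \<sigma> i)"
      if "i \<in> {0..<n}" "k \<in> {0..<n}" for i k
    proof (cases "i = k")
      case False
      with \<sigma> have "\<sigma> i \<noteq> \<sigma> k" by (meson inj_eq permutes_inj)
      moreover have "\<sigma> i < n" "\<sigma> k < n"
        using that permutes_in_image [OF \<sigma>] by auto
      ultimately show ?thesis
        using comm [of i "\<sigma> i" k "\<sigma> k"] that False by (simp add: commutator_def)
    qed simp
    then show ?thesis
      using fold_mult_eq_prod_list [of xs "\<lambda>i. M $$ (i, \<sigma> i)"] xs by simp
  qed
  show "unordered_det M = row_det M"
    unfolding unordered_det_def row_det_def
  proof (rule sum.cong)
    fix \<sigma> assume "\<sigma> \<in> {\<sigma>. \<sigma> permutes {0..<dim_row M}}"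
    then show "of_int (sign \<sigma>) * Finite_Set.fold (\<lambda>i p. M $$ (i, \<sigma> i) * p) 1 {0..<dim_row M} =
        of_int (sign \<sigma>) * prod_list (map (\<lambda>i. M $$ (i, \<sigma> i)) [0..<dim_row M])"
      using * [of \<sigma> "[0..<n]"] M by simp
  qed simp
  have "col_det M = (\<Sum>\<sigma> | \<sigma> permutes {0..<n}.
      of_int (sign (inv_into UNIV \<sigma>)) * prod_list (map (\<lambda>j. M $$ (inv_into UNIV \<sigma> j, j)) [0..<n]))"
    using M unfolding col_det_def by (subst sum_permutations_inverse) simp
  also have "\<dots> = unordered_det M"
    unfolding unordered_det_def
  proof (rule sum.cong)
    fix \<sigma> assume "\<sigma> \<in> {\<sigma>. \<sigma> permutes {0..<dim_row M}}"
    then have \<sigma>: "\<sigma> permutes {0..<n}" using M by simp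
    have "prod_list (map (\<lambda>j. M $$ (inv_into UNIV \<sigma> j, j)) [0..<n]) =
        prod_list (map (\<lambda>i. M $$ (i, \<sigma> i)) (map (inv_into UNIV \<sigma>) [0..<n]))"
      using permutes_inverses(1) [OF \<sigma>] by (simp add: o_def)
    also have "\<dots> = Finite_Set.fold (\<lambda>i p. M $$ (i, \<sigma> i) * p) 1 {0..<n}"
      using \<sigma> permutes_inv [OF \<sigma>]
      by (intro * [symmetric])
        (auto simp: distinct_map permutes_image permutes_inj_on simp flip: atLeastLessThan_upt)
    finally show "of_int (sign (inv_into UNIV \<sigma>)) * prod_list (map (\<lambda>j. M $$ (inv_into UNIV \<sigma> j, j)) [0..<n]) =
        of_int (sign \<sigma>) * Finite_Set.fold (\<lambda>i p. M $$ (i, \<sigma> i) * p) 1 {0..<dim_row M}"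
      using M \<sigma> by (simp add: sign_inverse permutes_imp_permutation [of "{0..<n}"])
  qed (use M in simp)
  finally show "unordered_det M = col_det M" ..
qed


section \<open>Formal series in the oscillator generators\<close>

text \<open>\<open>Ann\<close> stands for $a$ and \<open>Cre\<close> for $a^\dagger$. A series assigns a coefficient in $R$ to
  each word in the two letters; it represents a possibly infinite formal sum of words. The
  relation $[a,a^\dagger]=1$ is not imposed on the words: it enters through \<open>vac\<close>.\<close>

datatype osc = Ann | Cre

typedef 'a osc_series = "UNIV :: (osc list \<Rightarrow> 'a) set"
  morphisms scoeff Series ..

lemma scoeff_Series [simp]: "scoeff (Series f) = f"
  by (simp add: Series_inverse)

lemma osc_series_eqI: "(\<And>w. scoeff f w = scoeff g w) \<Longrightarrow> f = g"
  by (metis ext scoeff_inject)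

instantiation osc_series :: (ring_1) ring_1
begin

definition "0 = Series (\<lambda>w. 0)"
definition "1 = Series (\<lambda>w. if w = [] then 1 else 0)"
definition "f + g = Series (\<lambda>w. scoeff f w + scoeff g w)"
definition "f - g = Series (\<lambda>w. scoeff f w - scoeff g w)"
definition "- f = Series (\<lambda>w. - scoeff f w)"
definition "f * g = Series (\<lambda>w. \<Sum>k=0..length w. scoeff f (take k w) * scoeff g (drop k w))"

lemma scoeff_simps [simp]:
  "scoeff 0 w = (0::'a)"
  "scoeff 1 w = (if w = [] then 1 else (0::'a))"
  "scoeff (f + g) w = scoeff f w + (scoeff g w :: 'a)"
  "scoeff (f - g) w = scoeff f w - (scoeff g w :: 'a)"
  "scoeff (- f) w = - (scoeff f w :: 'a)"
  by (simp_all add: zero_osc_series_def one_osc_series_def plus_osc_series_def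
      minus_osc_series_def uminus_osc_series_def)

lemma scoeff_mult:
  "scoeff (f * g) w = (\<Sum>k=0..length w. scoeff f (take k w) * (scoeff g (drop k w) :: 'a))"
  by (simp add: times_osc_series_def)

instance
proof
  fix f g h :: "'a osc_series"
  show "f * g * h = f * (g * h)"
  proof (rule osc_series_eqI)
    fix w
    have "scoeff (f * g * h) w = (\<Sum>k=0..length w. \<Sum>i=0..k.
        scoeff f (take i w) * scoeff g (take (k - i) (drop i w)) * scoeff h (drop (length w - (length w - k)) w))"
    proof -
      have "scoeff f (take i (take k w)) * scoeff g (drop i (take k w)) * scoeff h (drop k w) =
          scoeff f (take i w) * scoeff g (take (k - i) (drop i w)) *
          scoeff h (drop (length w - (length w - k)) w)"
        if "k \<in> {0..length w}" "i \<in> {0..k}" for i k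
        using that by (simp add: drop_take min_absorb1)
      moreover have "scoeff (f * g * h) w = (\<Sum>k=0..length w. \<Sum>i=0..k.
          scoeff f (take i (take k w)) * scoeff g (drop i (take k w)) * scoeff h (drop k w))"
        unfolding scoeff_mult sum_distrib_right
        by (intro sum.cong refl) (auto simp: min_def split: if_splits)
      ultimately show ?thesis by (simp del: take_take)
    qed
    also have "\<dots> = (\<Sum>k=0..length w. \<Sum>i=0..length w - k.
        scoeff f (take k w) * scoeff g (take i (drop k w)) * scoeff h (drop (length w - (length w - k - i)) w))"
      by (rule fps_mult_assoc_lemma
          [of "\<lambda>i j l. scoeff f (take i w) * scoeff g (take j (drop i w)) * scoeff h (drop (length w - l) w)"])
    also have "\<dots> = scoeff (f * (g * h)) w"
      by (auto simp: scoeff_mult sum_distrib_left mult.assoc add.commute intro!: sum.cong)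
    finally show "scoeff (f * g * h) w = scoeff (f * (g * h)) w" .
  qed
  show "1 * f = f"
  proof (rule osc_series_eqI)
    fix w
    have "scoeff (1 * f) w = (\<Sum>k=0..length w. if k = 0 then scoeff f w else 0)"
      unfolding scoeff_mult by (rule sum.cong) auto
    then show "scoeff (1 * f) w = scoeff f w" by simp
  qed
  show "f * 1 = f"
  proof (rule osc_series_eqI)
    fix w
    have "scoeff (f * 1) w = (\<Sum>k=0..length w. if k = length w then scoeff f w else 0)"
      unfolding scoeff_mult by (rule sum.cong) auto
    then show "scoeff (f * 1) w = scoeff f w" by simp
  qed
  show "(0::'a osc_series) \<noteq> 1"
    by (metis scoeff_simps(1,2) zero_neq_one)
qed (auto intro!: osc_series_eqI simp: scoeff_mult algebra_simps sum.distrib)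

end

definition osc_const :: "'a::ring_1 \<Rightarrow> 'a osc_series" where
  "osc_const r = Series (\<lambda>w. if w = [] then r else 0)"

definition osc_gen :: "osc \<Rightarrow> 'a::ring_1 osc_series" where
  "osc_gen c = Series (\<lambda>w. if w = [c] then 1 else 0)"

text \<open>The series $\sum_{\nu\ge 0} c^\nu B^\nu$ for a generator $c$: the word $c^\nu$ has
  coefficient $B^\nu$.\<close>

definition osc_geometric :: "osc \<Rightarrow> 'a::ring_1 mat \<Rightarrow> 'a osc_series mat" where
  "osc_geometric c B = mat (dim_row B) (dim_col B) (\<lambda>(i,j).
     Series (\<lambda>w. if w = replicate (length w) c then (B ^\<^sub>m length w) $$ (i,j) else 0))"

text \<open>The matrix $c\,A + X (1 - d B)^{-1} Y$ for generators $c$ and $d$.\<close>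

definition osc_matrix ::
  "osc \<Rightarrow> osc \<Rightarrow> 'a::ring_1 mat \<Rightarrow> 'a mat \<Rightarrow> 'a mat \<Rightarrow> 'a mat \<Rightarrow> 'a osc_series mat" where
  "osc_matrix c d A B X Y =
     osc_gen c \<cdot>\<^sub>m map_mat osc_const A
     + map_mat osc_const X * osc_geometric d B * map_mat osc_const Y"


section \<open>Vacuum expectation\<close>

fun osc_act :: "osc \<Rightarrow> int poly \<Rightarrow> int poly" where
  "osc_act Ann p = pderiv p"
| "osc_act Cre p = [:0, 1:] * p"

text \<open>The rightmost letter of a word acts first.\<close>

definition vac :: "osc list \<Rightarrow> int" where
  "vac w = coeff (foldr osc_act w 1) 0"

text \<open>Only words with nonzero contribution are summed. The definition is meaningful only if
  there are finitely many of them; for the series considered here this is shown in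
  \<open>finite_col_det\<close> and \<open>finite_row_det\<close> below.\<close>

definition vac_expect :: "'a::ring_1 osc_series \<Rightarrow> 'a" where
  "vac_expect f = (\<Sum>w | scoeff f w \<noteq> 0 \<and> vac w \<noteq> 0. scoeff f w * of_int (vac w))"

lemma vac_nonzero_imp:
  assumes "vac w \<noteq> 0"
  shows "count_list w Ann = count_list w Cre"
proof -
  have "foldr osc_act w 1 = 0 \<or>
    (\<exists>c d. foldr osc_act w 1 = monom c d \<and> d + count_list w Ann = count_list w Cre)"
  proof (induction w)
    case Nil
    show ?case by (simp add: exI [of _ 1] monom_eq_1)
  next
    case (Cons x w)
    then consider "foldr osc_act w 1 = 0"
      | c d where "foldr osc_act w 1 = monom c d" "d + count_list w Ann = count_list w Cre"
      by blast
    then show ?case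
    proof cases
      case 1
      then show ?thesis by (cases x) auto
    next
      case 2
      show ?thesis
      proof (cases x)
        case Ann
        with 2 show ?thesis
          by (cases d) (auto simp: pderiv_monom monom_0 pderiv_pCons)
      next
        case Cre
        with 2 have "foldr osc_act (x # w) 1 = monom c (Suc d)"
          by (simp add: monom_Suc)
        moreover have "Suc d + count_list (x # w) Ann = count_list (x # w) Cre"
          using 2 Cre by simp
        ultimately show ?thesis by blast
      qed
    qed
  qed
  then show ?thesis
    using assms unfolding vac_def by (auto split: if_splits)
qed

definition letter_bound :: "osc \<Rightarrow> nat \<Rightarrow> 'a::ring_1 osc_series \<Rightarrow> bool" where
  "letter_bound c N f \<longleftrightarrow> (\<forall>w. scoeff f w \<noteq> 0 \<longrightarrow> count_list w c \<le> N)"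

lemma finite_letter_bound:
  assumes "letter_bound c N f"
  shows "finite {w. scoeff f w \<noteq> 0 \<and> vac w \<noteq> 0}"
proof (rule finite_subset)
  have len: "length w = count_list w Ann + count_list w Cre" for w
  proof (induction w)
    case (Cons x w)
    then show ?case by (cases x) auto
  qed simp
  show "{w. scoeff f w \<noteq> 0 \<and> vac w \<noteq> 0} \<subseteq> {w. set w \<subseteq> {Ann, Cre} \<and> length w \<le> 2 * N}"
  proof
    fix w assume "w \<in> {w. scoeff f w \<noteq> 0 \<and> vac w \<noteq> 0}"
    then have *: "scoeff f w \<noteq> 0" "vac w \<noteq> 0" by auto
    then have "count_list w c \<le> N"
      using assms by (simp add: letter_bound_def)
    with vac_nonzero_imp [OF *(2)] have "length w \<le> 2 * N"
      by (cases c) (simp_all add: len)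
    moreover have "set w \<subseteq> {Ann, Cre}"
      using osc.exhaust by blast
    ultimately show "w \<in> {w. set w \<subseteq> {Ann, Cre} \<and> length w \<le> 2 * N}" by simp
  qed
  show "finite {w. set w \<subseteq> {Ann, Cre} \<and> length w \<le> 2 * N}"
    by (rule finite_lists_length_le) simp
qed

lemma letter_bound_mult:
  assumes "letter_bound c N f" "letter_bound c K g"
  shows "letter_bound c (N + K) (f * g)"
  unfolding letter_bound_def
proof safe
  fix w assume "scoeff (f * g) w \<noteq> 0"
  then obtain k where "scoeff f (take k w) * scoeff g (drop k w) \<noteq> 0"
    unfolding scoeff_mult by (meson sum.not_neutral_contains_not_neutral)
  then have "scoeff f (take k w) \<noteq> 0" "scoeff g (drop k w) \<noteq> 0" by auto
  then have "count_list (take k w) c \<le> N" "count_list (drop k w) c \<le> K"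
    using assms by (auto simp: letter_bound_def)
  then show "count_list w c \<le> N + K"
    using count_list_append [of "take k w" "drop k w" c] by simp
qed

lemma letter_bound_add:
  "letter_bound c N f \<Longrightarrow> letter_bound c N g \<Longrightarrow> letter_bound c N (f + g)"
  unfolding letter_bound_def by (metis scoeff_simps(3) add.right_neutral)

lemma letter_bound_sum:
  "(\<And>x. x \<in> S \<Longrightarrow> letter_bound c N (f x)) \<Longrightarrow> letter_bound c N (sum f S)"
proof (induction S rule: infinite_finite_induct)
  case (insert x S)
  then show ?case by (simp add: letter_bound_add)
qed (simp_all add: letter_bound_def)

lemma letter_bound_mono: "letter_bound c N f \<Longrightarrow> N \<le> K \<Longrightarrow> letter_bound c K f"
  unfolding letter_bound_def by (meson le_trans)

lemma letter_bound_prod_list: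
  "(\<And>f. f \<in> set fs \<Longrightarrow> letter_bound c 1 f) \<Longrightarrow> letter_bound c (length fs) (prod_list fs)"
proof (induction fs)
  case Nil
  show ?case by (simp add: letter_bound_def)
next
  case (Cons f fs)
  then show ?case
    using letter_bound_mult [of c 1 f "length fs" "prod_list fs"] by simp
qed

lemma letter_bound_sign: "letter_bound c 0 (of_int (sign \<sigma>))"
  by (auto simp: sign_def letter_bound_def)

lemma letter_bound_osc_matrix:
  assumes "c \<noteq> d" "X \<in> carrier_mat n m" "Y \<in> carrier_mat m n"
    "A \<in> carrier_mat n n" "B \<in> carrier_mat m m" and ij: "i < n" "j < n"
  shows "letter_bound c 1 (osc_matrix c d A B X Y $$ (i,j))"
proof -
  have const: "letter_bound c 0 (osc_const r)" for r :: 'a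
    by (simp add: letter_bound_def osc_const_def)
  have geo: "letter_bound c 0 (osc_geometric d B $$ (k,l))" if "k < m" "l < m" for k l
  proof -
    have "count_list (replicate N d) c = 0" for N
      using assms(1) by (induction N) auto
    then show ?thesis
      using that assms(5) unfolding osc_geometric_def letter_bound_def
      by (auto split: if_splits) metis
  qed
  have G: "osc_geometric d B \<in> carrier_mat m m"
    using assms(5) by (simp add: osc_geometric_def)
  have "osc_matrix c d A B X Y $$ (i,j) = osc_gen c * osc_const (A $$ (i,j)) +
      (\<Sum>l = 0..<m. (\<Sum>k = 0..<m. osc_const (X $$ (i,k)) * osc_geometric d B $$ (k,l))
        * osc_const (Y $$ (l,j)))"
    using assms G unfolding osc_matrix_def by (simp add: scalar_prod_def del: assoc_mult_mat)
  moreover have "letter_bound c 1 (osc_gen c * osc_const (A $$ (i,j)))"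
  proof -
    have "letter_bound c 1 (osc_gen c :: 'a osc_series)"
      by (simp add: letter_bound_def osc_gen_def)
    from letter_bound_mult [OF this const] show ?thesis by simp
  qed
  moreover have "letter_bound c 1 (\<Sum>l = 0..<m.
      (\<Sum>k = 0..<m. osc_const (X $$ (i,k)) * osc_geometric d B $$ (k,l)) * osc_const (Y $$ (l,j)))"
  proof (rule letter_bound_mono [OF letter_bound_sum])
    fix l assume l: "l \<in> {0..<m}"
    have "letter_bound c (0 + 0)
        (\<Sum>k = 0..<m. osc_const (X $$ (i,k)) * osc_geometric d B $$ (k,l))"
      using l by (intro letter_bound_sum letter_bound_mult const geo) auto
    from letter_bound_mult [OF this const]
    show "letter_bound c (0 + 0 + 0)
        ((\<Sum>k = 0..<m. osc_const (X $$ (i,k)) * osc_geometric d B $$ (k,l)) * osc_const (Y $$ (l,j)))" .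
  qed simp
  ultimately show ?thesis
    by (simp only: letter_bound_add)
qed

lemma
  assumes "c \<noteq> d" "X \<in> carrier_mat n m" "Y \<in> carrier_mat m n"
    "A \<in> carrier_mat n n" "B \<in> carrier_mat m m"
  shows finite_col_det: "finite {w. scoeff (col_det (osc_matrix c d A B X Y)) w \<noteq> 0 \<and> vac w \<noteq> 0}"
    and finite_row_det: "finite {w. scoeff (row_det (osc_matrix c d A B X Y)) w \<noteq> 0 \<and> vac w \<noteq> 0}"
proof -
  let ?M = "osc_matrix c d A B X Y"
  have dim: "dim_row ?M = n" "dim_col ?M = n"
    using assms by (simp_all add: osc_matrix_def)
  have entry: "letter_bound c 1 (?M $$ (i,j))" if "i < n" "j < n" for i j
    using letter_bound_osc_matrix [OF assms that] .
  have lt: "\<sigma> j < n" if "\<sigma> permutes {0..<n}" "j < n" for \<sigma> j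
    using permutes_in_image [OF that(1), of j] that(2) by simp
  have term_bound: "letter_bound c n (of_int (sign \<sigma>) * prod_list fs)"
    if "length fs = n" "\<And>f::'a osc_series. f \<in> set fs \<Longrightarrow> letter_bound c 1 f" for fs \<sigma>
    using letter_bound_mult [OF letter_bound_sign letter_bound_prod_list [of fs c], of \<sigma>] that
    by simp
  have col: "letter_bound c n (col_det ?M)"
    unfolding col_det_def dim
  proof (rule letter_bound_sum)
    fix \<sigma> assume "\<sigma> \<in> {\<sigma>. \<sigma> permutes {0..<n}}"
    then have "\<sigma> permutes {0..<n}" by simp
    then show "letter_bound c n (of_int (sign \<sigma>) * prod_list (map (\<lambda>j. ?M $$ (\<sigma> j, j)) [0..<n]))"
      by (intro term_bound) (auto simp del: One_nat_def intro: entry lt)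
  qed
  have row: "letter_bound c n (row_det ?M)"
    unfolding row_det_def dim
  proof (rule letter_bound_sum)
    fix \<sigma> assume "\<sigma> \<in> {\<sigma>. \<sigma> permutes {0..<n}}"
    then have "\<sigma> permutes {0..<n}" by simp
    then show "letter_bound c n (of_int (sign \<sigma>) * prod_list (map (\<lambda>i. ?M $$ (i, \<sigma> i)) [0..<n]))"
      by (intro term_bound) (auto simp del: One_nat_def intro: entry lt)
  qed
  show "finite {w. scoeff (col_det ?M) w \<noteq> 0 \<and> vac w \<noteq> 0}"
    by (rule finite_letter_bound [OF col])
  show "finite {w. scoeff (row_det ?M) w \<noteq> 0 \<and> vac w \<noteq> 0}"
    by (rule finite_letter_bound [OF row])
qed

end

(* The proof is by Grassmann variables eta_i. Put chi_j = sum_i eta_i X_ij and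
   alpha_l = sum_i eta_i A_il. Row-pseudo-commutativity of X says that the chi_j anticommute, and
   the condition on [X, A] that chi_j and alpha_l anticommute; so the left-hand side of (a) is the
   coefficient of eta_1 ... eta_n in
     F = sum_g chi_g(1) ... chi_g(n) Y_g(1),1 ... Y_g(n),n,
   summed over all maps g from [n] to [m]. Replace column l of Y by the power series
   v_l(t) = (1 - tB)^{-1} y_l. Moving v_1 to the left through the chi's produces terms in which some
   v_l is replaced by B (1 - tB)^{-1} v_l, which is dv_l/dt. Hence
     F(v_1, ..., v_n) = (chi . v_1) F(v_2, ..., v_n) + alpha_1 d/dt F(v_2, ..., v_n),
   and F is the product of the operators alpha_l d/dt + chi (1 - tB)^{-1} y_l applied to 1. At t = 0
   this is the vacuum expectation, with a acting as d/dt and a^dagger as multiplication by t.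
   Part (b) is part (a) over the opposite ring, for the matrices reflected in the antidiagonal, since
   reversing a word and exchanging a and a^dagger does not change its expectation. *)
theory Submission
  imports Defs
begin

section \<open>Anticommuting families\<close>

text \<open>A recursion for F with the bare columns y_l would not close: moving y_1 to the left puts
  B y_l in place of y_l, the next column brings in B^2 y_l, and so on. The series v_l(t) holds all
  the columns B^r y_l at once, so that the correction is a derivative of the same F; the left-hand
  side of (a) is recovered at t = 0. Of the entries only those of B commute with everything, so the
  coefficient of eta_1 ... eta_n is taken over a noncommutative ring, and r has to be recoverable
  from eta_1 ... eta_n r. For this reason the Grassmann algebra is realised by operators: the
  coefficient is read off by applying an operator to one fixed function. The number 2 may be a zero
  divisor, so that squares being zero is a condition separate from anticommutation. Anticommutation
  of the chi_j comes from the first half of pseudo-commutativity, the vanishing of their squares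
  from the second.\<close>

locale anticommuting =
  fixes e :: "nat \<Rightarrow> 's::ring_1"
  assumes anticommute: "e i * e j = - (e j * e i)" and square_zero: "e i * e i = 0"
begin

definition wedge :: "nat list \<Rightarrow> 's" where
  "wedge xs = prod_list (map e xs)"

lemma wedge_simps [simp]:
  "wedge [] = 1" "wedge (x # xs) = e x * wedge xs" "wedge (xs @ ys) = wedge xs * wedge ys"
  by (simp_all add: wedge_def)

lemma move_past_wedge: "e x * wedge v = (-1) ^ length v * (wedge v * e x)"
proof (induction v)
  case (Cons y v)
  have "e x * (e y * wedge v) = - (e y * (e x * wedge v))"
    by (simp add: anticommute [of x y] flip: mult.assoc)
  also have "e y * ((-1) ^ length v * z) = (-1) ^ length v * (e y * z)" for z
    by (cases "even (length v)") simp_all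
  then have "- (e y * (e x * wedge v)) = - ((-1) ^ length v * (e y * (wedge v * e x)))"
    by (simp add: Cons.IH)
  finally show ?case by (simp add: mult.assoc)
qed simp

text \<open>\<open>e x\<close> and \<open>e y\<close> pass \<open>v\<close> with the same sign, so
  what remains is the sign of exchanging them as neighbours.\<close>

lemma wedge_swap: "wedge (u @ x # v @ y # w) = - wedge (u @ y # v @ x # w)"
proof -
  have "e x * wedge v * e y = (-1) ^ length v * (wedge v * (e x * e y))"
    by (simp add: move_past_wedge mult.assoc)
  also have "\<dots> = - ((-1) ^ length v * (wedge v * (e y * e x)))"
    by (simp add: anticommute [of x y])
  also have "\<dots> = - (e y * wedge v * e x)"
    by (simp add: move_past_wedge mult.assoc)
  finally have "e x * wedge v * e y = - (e y * wedge v * e x)" .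
  then have "wedge u * (e x * wedge v * e y) * wedge w = - (wedge u * (e y * wedge v * e x) * wedge w)"
    by simp
  then show ?thesis by (simp add: mult.assoc)
qed

lemma wedge_not_distinct:
  assumes "\<not> distinct xs"
  shows "wedge xs = 0"
proof -
  obtain u x v w where xs: "xs = u @ [x] @ v @ [x] @ w"
    using not_distinct_decomp [OF assms] by blast
  have "e x * wedge v * e x = 0"
    by (simp add: move_past_wedge mult.assoc square_zero)
  then have "e x * (wedge v * (e x * z)) = 0" for z
    by (simp flip: mult.assoc)
  then show ?thesis by (simp add: xs)
qed

lemma wedge_transpose:
  assumes "a < b" "b < length xs"
  shows "wedge (permute_list (Transposition.transpose a b) xs) = - wedge xs"
proof -
  define u v w where "u = take a xs" and "v = take (b - Suc a) (drop (Suc a) xs)"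
    and "w = drop (Suc b) xs"
  have xs: "xs = u @ xs ! a # v @ xs ! b # w"
  proof -
    have "xs = u @ xs ! a # drop (Suc a) xs"
      using assms by (simp add: u_def id_take_nth_drop)
    moreover have "drop (Suc a) xs = v @ drop (b - Suc a) (drop (Suc a) xs)"
      unfolding v_def by (metis append_take_drop_id)
    moreover have "drop (b - Suc a) (drop (Suc a) xs) = xs ! b # w"
      using assms by (simp add: w_def Cons_nth_drop_Suc)
    ultimately show ?thesis by metis
  qed
  have lens: "length u = a" "length v = b - Suc a"
    using assms by (auto simp: u_def v_def)
  have "permute_list (Transposition.transpose a b) xs = u @ xs ! b # v @ xs ! a # w"
  proof (rule nth_equalityI)
    show "length (permute_list (Transposition.transpose a b) xs) = length (u @ xs ! b # v @ xs ! a # w)"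
      using arg_cong [OF xs, of length] by simp
  next
    fix i assume "i < length (permute_list (Transposition.transpose a b) xs)"
    then have i: "i < length xs" by simp
    then have l: "permute_list (Transposition.transpose a b) xs ! i = xs ! Transposition.transpose a b i"
      by (simp add: permute_list_def)
    consider "i = a" | "i = b" | "i \<noteq> a" "i \<noteq> b" by blast
    then show "permute_list (Transposition.transpose a b) xs ! i = (u @ xs ! b # v @ xs ! a # w) ! i"
    proof cases
      case 3
      then have "xs ! i = (u @ xs ! b # v @ xs ! a # w) ! i"
        using assms lens by (subst xs) (auto simp: nth_append nth_Cons' Suc_diff_Suc)
      with 3 l show ?thesis by simp
    qed (use l lens assms in \<open>auto simp: nth_append\<close>)
  qed
  then show ?thesis
    using wedge_swap [of u "xs ! b" v "xs ! a" w] xs by metis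
qed

lemma wedge_permute:
  assumes "p permutes {..<N}" and "length xs = N"
  shows "wedge (permute_list p xs) = of_int (sign p) * wedge xs"
  using assms(1) finite_lessThan assms(2)
proof (induction arbitrary: xs rule: permutes_induct)
  case (swap a b p)
  let ?t = "Transposition.transpose a b"
  have t: "?t permutes {..<length xs}"
    by (rule permutes_swap_id) (use swap.hyps swap.prems in auto)
  have "wedge (permute_list ?t xs) = - wedge xs"
    using swap.hyps swap.prems wedge_transpose [of a b xs] wedge_transpose [of b a xs]
    by (cases "a < b") (auto simp: transpose_commute)
  \<comment> \<open>Composition acts on lists contravariantly: \<open>?t\<close> permutes
    \<open>xs\<close> before \<open>p\<close> does. Hence the induction hypothesis is needed at the
    permuted list.\<close>
  moreover have "wedge (permute_list (?t \<circ> p) xs) = of_int (sign p) * wedge (permute_list ?t xs)"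
    using swap.IH [of "permute_list ?t xs"] swap.prems swap.hyps permute_list_compose [of p xs ?t] by simp
  moreover have "sign (?t \<circ> p) = - sign p"
    using swap.hyps by (subst sign_compose)
      (auto simp: permutation_swap_id sign_swap_id intro: permutes_imp_permutation [of "{..<N}"])
  ultimately show ?case
    by (simp add: comp_def)
qed simp

end

lemma bij_betw_permute_list:
  assumes "distinct xs"
  shows "bij_betw (\<lambda>\<tau>. permute_list \<tau> xs) {\<tau>. \<tau> permutes {..<length xs}}
    {ys. distinct ys \<and> set ys = set xs}"
  unfolding bij_betw_def
proof
  show "inj_on (\<lambda>\<tau>. permute_list \<tau> xs) {\<tau>. \<tau> permutes {..<length xs}}"
  proof (rule inj_onI, rule ext)
    fix p q i assume "p \<in> {\<tau>. \<tau> permutes {..<length xs}}" "q \<in> {\<tau>. \<tau> permutes {..<length xs}}"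
      and eq: "permute_list p xs = permute_list q xs"
    then have p: "p permutes {..<length xs}" and q: "q permutes {..<length xs}" by auto
    show "p i = q i"
    proof (cases "i < length xs")
      case True
      then have "xs ! p i = xs ! q i"
        using eq permute_list_nth [OF p] permute_list_nth [OF q] by metis
      then show ?thesis
        using True assms permutes_in_image [OF p, of i] permutes_in_image [OF q, of i]
        by (simp add: nth_eq_iff_index_eq)
    qed (use p q in \<open>auto simp: permutes_def\<close>)
  qed
  show "(\<lambda>\<tau>. permute_list \<tau> xs) ` {\<tau>. \<tau> permutes {..<length xs}} = {ys. distinct ys \<and> set ys = set xs}"
  proof safe
    fix ys assume "distinct ys" "set ys = set xs"
    then have "mset ys = mset xs"
      using assms by (metis set_eq_iff_mset_eq_distinct)
    then obtain p where "p permutes {..<length xs}" "permute_list p xs = ys"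
      by (rule mset_eq_permutation)
    then show "ys \<in> (\<lambda>\<tau>. permute_list \<tau> xs) ` {\<tau>. \<tau> permutes {..<length xs}}" by blast
  qed (use assms in auto)
qed

context anticommuting
begin

text \<open>Lists with a repetition contribute nothing. The others are grouped by their set of
  entries, and sorting such a list costs the sign of a permutation. This is the source of the
  subsets \<open>L\<close> and of the alternating sums over the rows of Y.\<close>

theorem sum_wedge:
  "(\<Sum>g | set g \<subseteq> {0..<m} \<and> length g = n. wedge g * h g) =
   (\<Sum>L | L \<subseteq> {0..<m} \<and> card L = n. wedge (sorted_list_of_set L) *
      (\<Sum>\<tau> | \<tau> permutes {0..<n}. of_int (sign \<tau>) * h (permute_list \<tau> (sorted_list_of_set L))))"
proof -
  let ?S = "{g. set g \<subseteq> {0..<m} \<and> length g = n}"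
  let ?S' = "{g \<in> ?S. distinct g}"
  let ?T = "{L. L \<subseteq> {0..<m} \<and> card L = n}"
  have fin: "finite ?S" by (rule finite_lists_length_eq) simp
  have "(\<Sum>g\<in>?S. wedge g * h g) = (\<Sum>g\<in>?S'. wedge g * h g)"
    using fin by (intro sum.mono_neutral_right) (auto simp: wedge_not_distinct)
  also have "\<dots> = (\<Sum>L\<in>?T. \<Sum>g\<in>{g\<in>?S'. set g = L}. wedge g * h g)"
  proof (rule sum.group [symmetric])
    show "finite ?S'" by (rule finite_subset [OF _ fin]) blast
  qed (auto simp: distinct_card)
  also have "\<dots> = (\<Sum>L\<in>?T. wedge (sorted_list_of_set L) *
      (\<Sum>\<tau> | \<tau> permutes {0..<n}. of_int (sign \<tau>) * h (permute_list \<tau> (sorted_list_of_set L))))"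
  proof (rule sum.cong)
    fix L assume L: "L \<in> ?T"
    then have finL: "finite L" by (auto intro: finite_subset)
    let ?l = "sorted_list_of_set L"
    have l: "distinct ?l" "set ?l = L" "length ?l = n"
      using L finL by auto
    have "{g\<in>?S'. set g = L} = {ys. distinct ys \<and> set ys = set ?l}"
      using L l by (auto simp: distinct_card)
    then have "(\<Sum>g\<in>{g\<in>?S'. set g = L}. wedge g * h g) =
        (\<Sum>\<tau> | \<tau> permutes {..<length ?l}. wedge (permute_list \<tau> ?l) * h (permute_list \<tau> ?l))"
      using sum.reindex_bij_betw [OF bij_betw_permute_list [OF l(1)], of "\<lambda>g. wedge g * h g"] by simp
    also have "\<dots> = (\<Sum>\<tau> | \<tau> permutes {..<length ?l}.
        wedge ?l * (of_int (sign \<tau>) * h (permute_list \<tau> ?l)))"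
      by (intro sum.cong refl) (auto simp: wedge_permute sign_def)
    finally show "(\<Sum>g\<in>{g\<in>?S'. set g = L}. wedge g * h g) = wedge ?l *
      (\<Sum>\<tau> | \<tau> permutes {0..<n}. of_int (sign \<tau>) * h (permute_list \<tau> ?l))"
      using l(3) by (simp add: sum_distrib_left atLeast0LessThan)
  qed simp
  finally show ?thesis .
qed

end

text \<open>In top degree the full set is the only subset, so a sum over lists collapses to a single
  alternating sum. Column determinants arise in this way from products of one-forms.\<close>

lemma sum_wedge_full:
  assumes "anticommuting e"
  shows "(\<Sum>g | set g \<subseteq> {0..<n} \<and> length g = n. anticommuting.wedge e g * h g) =
    anticommuting.wedge e [0..<n] * (\<Sum>\<tau> | \<tau> permutes {0..<n}. of_int (sign \<tau>) * h (map \<tau> [0..<n]))"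
proof -
  interpret anticommuting e by fact
  have "{L. L \<subseteq> {0..<n} \<and> card L = n} = {{0..<n}}"
    using card_subset_eq [of "{0..<n}"] by auto
  moreover have "permute_list \<tau> [0..<n] = map \<tau> [0..<n]" if "\<tau> permutes {0..<n}" for \<tau>
    using permutes_in_image [OF that] by (auto simp: permute_list_def)
  ultimately show ?thesis
    unfolding sum_wedge by (auto intro!: arg_cong [where f = "\<lambda>x. _ * x"] sum.cong)
qed

section \<open>Exchange relations and derivations\<close>

lemma sum_lists_Suc:
  assumes "finite S"
  shows "(\<Sum>g | set g \<subseteq> S \<and> length g = Suc n. h g) =
    (\<Sum>k\<in>S. \<Sum>g | set g \<subseteq> S \<and> length g = n. h (k # g))"
proof -
  have "(\<Sum>k\<in>S. \<Sum>g | set g \<subseteq> S \<and> length g = n. h (k # g)) =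
      (\<Sum>(k, g) \<in> S \<times> {g. set g \<subseteq> S \<and> length g = n}. h (k # g))"
    by (subst sum.cartesian_product) simp
  also have "\<dots> = (\<Sum>g | set g \<subseteq> S \<and> length g = Suc n. h g)"
    by (rule sum.reindex_bij_witness [of _ "\<lambda>g. (hd g, tl g)" "\<lambda>(k, g). k # g"])
      (auto simp: length_Suc_conv)
  finally show ?thesis ..
qed

text \<open>In the application this supplies the Y-factors of the term of F that belongs to the map
  \<open>g\<close>.\<close>

fun contract :: "(nat \<Rightarrow> 't::ring_1) list \<Rightarrow> nat list \<Rightarrow> 't" where
  "contract [] [] = 1"
| "contract (v # vs) (k # g) = v k * contract vs g"
| "contract _ _ = 0"

text \<open>Exchanging \<open>\<chi> j\<close> with \<open>v k\<close> leaves a term with \<open>\<beta> k j\<close>. The assumption \<open>D_V\<close> turns the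
  sum of these terms over the factors of a product into a derivative.\<close>

locale derivation_family =
  fixes m :: nat and \<chi> :: "nat \<Rightarrow> 't::ring_1" and \<beta> :: "nat \<Rightarrow> nat \<Rightarrow> 't"
    and D :: "'t \<Rightarrow> 't" and V :: "(nat \<Rightarrow> 't) set"
  assumes \<chi>_anticommute: "\<chi> j * \<chi> k = - (\<chi> k * \<chi> j)"
    and \<beta>_\<chi>: "\<beta> j k * \<chi> i = \<chi> i * \<beta> j k"
    and \<beta>_V: "v \<in> V \<Longrightarrow> \<beta> j k * v i = v i * \<beta> j k"
    and D_one: "D 1 = 0"
    and D_add: "D (x + y) = D x + D y"
    and D_mult: "D (x * y) = x * D y + D x * y"
    and D_\<chi>: "D (\<chi> j) = 0"
    and D_V: "v \<in> V \<Longrightarrow> D (v k) = (\<Sum>j = 0..<m. \<beta> k j * v j)"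
begin

definition exch :: "nat list \<Rightarrow> 't" where
  "exch g = prod_list (map \<chi> g)"

lemma exch_simps [simp]: "exch [] = 1" "exch (k # g) = \<chi> k * exch g"
  by (simp_all add: exch_def)

text \<open>\<open>replace k g\<close> is the sum over the positions \<open>s\<close> of \<open>g\<close> of \<open>\<beta> k (g ! s)\<close> times the product
  of the \<open>\<chi>\<close>'s with \<open>k\<close> written at position \<open>s\<close>.\<close>

fun replace :: "nat \<Rightarrow> nat list \<Rightarrow> 't" where
  "replace k [] = 0"
| "replace k (h # g) = \<beta> k h * (\<chi> k * exch g) + \<chi> h * replace k g"

text \<open>Crossing the factor at position s of \<open>g\<close>, counted from 1, \<open>v\<close>
  leaves minus \<open>\<alpha>\<close> times a \<open>\<beta>\<close>. Bringing
  \<open>\<alpha>\<close> to the front costs s signs, since it also crosses the leading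
  \<open>\<chi> k\<close>; moving \<open>\<chi> k\<close> into the vacant position costs s - 1.
  Together with the minus sign these multiply to 1 for every s, so the corrections add up without
  signs, as in the Leibniz rule.\<close>

lemma exch_commute:
  assumes v: "\<And>j. \<chi> j * v = v * \<chi> j - \<alpha> * \<beta> k j"
    and \<alpha>: "\<And>j. \<chi> j * \<alpha> = - (\<alpha> * \<chi> j)"
  shows "\<chi> k * (exch g * v) = \<chi> k * (v * exch g) + \<alpha> * replace k g"
proof (induction g)
  case (Cons h g)
  have "\<chi> k * (\<chi> h * z) = - (\<chi> h * (\<chi> k * z))" for z
    by (simp add: \<chi>_anticommute [of k h] flip: mult.assoc)
  \<comment> \<open>The exchange with \<open>\<chi> h\<close> puts \<open>\<chi> k\<close> next to
    \<open>exch g * v\<close>, where the induction hypothesis applies; it is undone once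
    \<open>v\<close> has passed \<open>exch g\<close>.\<close>
  then have "\<chi> k * (exch (h # g) * v) = - (\<chi> h * (\<chi> k * (exch g * v)))"
    by (simp add: mult.assoc)
  also have "\<dots> = - (\<chi> h * (\<chi> k * (v * exch g))) - \<chi> h * (\<alpha> * replace k g)"
    by (simp add: Cons.IH algebra_simps)
  also have "\<chi> h * (\<alpha> * z) = - (\<alpha> * (\<chi> h * z))" for z
    by (simp add: \<alpha> flip: mult.assoc)
  also have "- (\<chi> h * (\<chi> k * (v * exch g))) = \<chi> k * (\<chi> h * (v * exch g))"
    by (simp add: \<chi>_anticommute [of k h] flip: mult.assoc)
  also have "\<chi> h * (v * exch g) = v * (\<chi> h * exch g) - \<alpha> * (\<beta> k h * exch g)"
    by (simp add: v left_diff_distrib flip: mult.assoc)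
  also have "\<chi> k * (v * (\<chi> h * exch g) - \<alpha> * (\<beta> k h * exch g)) =
      \<chi> k * (v * exch (h # g)) + \<alpha> * (\<chi> k * (\<beta> k h * exch g))"
    using \<alpha> [of k] by (simp add: right_diff_distrib flip: mult.assoc)
  also have "\<chi> k * (\<beta> k h * exch g) = \<beta> k h * (\<chi> k * exch g)"
    by (simp add: \<beta>_\<chi> flip: mult.assoc)
  finally show ?case
    by (simp add: algebra_simps)
qed simp

lemma D_zero: "D 0 = 0"
  using D_add [of 0 0] by simp

lemma D_sum: "D (sum f S) = (\<Sum>x\<in>S. D (f x))"
  by (induction S rule: infinite_finite_induct) (simp_all add: D_zero D_add)

lemma D_exch: "D (exch g) = 0"
  by (induction g) (simp_all add: D_one D_mult D_\<chi>)

text \<open>Two summation indices change roles: the written index \<open>k\<close> becomes the value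
  of the map at the replaced position, and the old value there becomes the index summed in
  \<open>\<beta> k j * v j\<close>, which is \<open>D (v k)\<close> by \<open>D_V\<close>. The sum
  over the positions is then the Leibniz rule. In the induction \<open>z\<close> collects the
  contracted factors that \<open>\<beta>\<close> has to cross before it meets its own.\<close>

lemma sum_replace:
  assumes "set vs \<subseteq> V" and z: "\<And>j k. \<beta> j k * z = z * \<beta> j k"
  shows "(\<Sum>k = 0..<m. \<Sum>g | set g \<subseteq> {0..<m} \<and> length g = length vs.
      replace k g * (z * contract vs g)) =
    (\<Sum>g | set g \<subseteq> {0..<m} \<and> length g = length vs. exch g * (z * D (contract vs g)))"
  using assms
proof (induction vs arbitrary: z)
  case Nil
  then show ?case by (simp add: D_one cong: conj_cong)
next
  case (Cons u us)
  then have u: "u \<in> V" and us: "set us \<subseteq> V" by auto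
  let ?S = "{g. set g \<subseteq> {0..<m} \<and> length g = length us}"
  have zu: "\<beta> j k * (z * u h) = (z * u h) * \<beta> j k" for j k h
  proof -
    have "\<beta> j k * (z * u h) = z * (\<beta> j k * u h)"
      by (simp add: Cons.prems(2) flip: mult.assoc)
    then show ?thesis by (simp add: \<beta>_V [OF u] mult.assoc)
  qed
  have "(\<Sum>k = 0..<m. \<Sum>g | set g \<subseteq> {0..<m} \<and> length g = length (u # us).
      replace k g * (z * contract (u # us) g)) =
    (\<Sum>k = 0..<m. \<Sum>h = 0..<m. \<Sum>g\<in>?S. \<beta> k h * (\<chi> k * exch g) * (z * (u h * contract us g))) +
    (\<Sum>k = 0..<m. \<Sum>h = 0..<m. \<Sum>g\<in>?S. \<chi> h * (replace k g * ((z * u h) * contract us g)))"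
    by (simp add: sum_lists_Suc sum.distrib distrib_right mult.assoc)
  also have "(\<Sum>k = 0..<m. \<Sum>h = 0..<m. \<Sum>g\<in>?S. \<chi> h * (replace k g * ((z * u h) * contract us g))) =
      (\<Sum>h = 0..<m. \<chi> h * (\<Sum>k = 0..<m. \<Sum>g\<in>?S. replace k g * ((z * u h) * contract us g)))"
    by (subst sum.swap) (simp add: sum_distrib_left)
  also have "\<dots> = (\<Sum>h = 0..<m. \<chi> h * (\<Sum>g\<in>?S. exch g * ((z * u h) * D (contract us g))))"
    by (simp only: Cons.IH [OF us zu])
  also have "\<dots> = (\<Sum>h = 0..<m. \<Sum>g\<in>?S. exch (h # g) * (z * (u h * D (contract us g))))"
    by (simp add: sum_distrib_left mult.assoc)
  also have "(\<Sum>k = 0..<m. \<Sum>h = 0..<m. \<Sum>g\<in>?S. \<beta> k h * (\<chi> k * exch g) * (z * (u h * contract us g))) =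
      (\<Sum>k = 0..<m. \<Sum>g\<in>?S. exch (k # g) * (z * (D (u k) * contract us g)))"
  proof (rule sum.cong)
    fix k
    have \<beta>_exch: "\<beta> k h * exch g = exch g * \<beta> k h" for h g
    proof (induction g)
      case (Cons a g)
      have "\<beta> k h * exch (a # g) = \<chi> a * (\<beta> k h * exch g)"
        by (simp add: \<beta>_\<chi> flip: mult.assoc)
      then show ?case by (simp add: Cons.IH mult.assoc)
    qed simp
    have "\<beta> k h * (\<chi> k * exch g) * (z * (u h * w)) = exch (k # g) * (z * (\<beta> k h * u h * w))" for h g w
    proof -
      have "\<beta> k h * (\<chi> k * exch g) * (z * (u h * w)) = exch (k # g) * (\<beta> k h * z) * (u h * w)"
        using \<beta>_exch [of h "k # g"] by (simp add: mult.assoc)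
      then show ?thesis by (simp add: Cons.prems(2) mult.assoc)
    qed
    then have "(\<Sum>h = 0..<m. \<Sum>g\<in>?S. \<beta> k h * (\<chi> k * exch g) * (z * (u h * contract us g))) =
        (\<Sum>g\<in>?S. \<Sum>h = 0..<m. exch (k # g) * (z * (\<beta> k h * u h * contract us g)))"
      by (subst sum.swap) (simp del: exch_simps)
    also have "\<dots> = (\<Sum>g\<in>?S. exch (k # g) * (z * (D (u k) * contract us g)))"
      by (simp add: D_V [OF u] sum_distrib_left sum_distrib_right del: exch_simps)
    finally show "(\<Sum>h = 0..<m. \<Sum>g\<in>?S. \<beta> k h * (\<chi> k * exch g) * (z * (u h * contract us g))) =
        (\<Sum>g\<in>?S. exch (k # g) * (z * (D (u k) * contract us g)))" .
  qed simp
  finally show ?case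
    by (simp add: sum_lists_Suc D_mult sum.distrib distrib_left algebra_simps)
qed

text \<open>This is F(v_1, ..., v_n).\<close>

definition pairing :: "(nat \<Rightarrow> 't) list \<Rightarrow> 't" where
  "pairing vs = (\<Sum>g | set g \<subseteq> {0..<m} \<and> length g = length vs. exch g * contract vs g)"

theorem pairing_Cons:
  assumes "set vs \<subseteq> V"
    and v: "\<And>j k. \<chi> j * v k = v k * \<chi> j - \<alpha> * \<beta> k j"
    and \<alpha>: "\<And>j. \<chi> j * \<alpha> = - (\<alpha> * \<chi> j)"
  shows "pairing (v # vs) = (\<Sum>k = 0..<m. \<chi> k * v k) * pairing vs + \<alpha> * D (pairing vs)"
proof -
  let ?S = "{g. set g \<subseteq> {0..<m} \<and> length g = length vs}"
  have "pairing (v # vs) = (\<Sum>k = 0..<m. \<Sum>g\<in>?S. \<chi> k * (exch g * v k) * contract vs g)"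
    by (simp add: pairing_def sum_lists_Suc mult.assoc)
  also have "\<dots> = (\<Sum>k = 0..<m. \<Sum>g\<in>?S. \<chi> k * v k * (exch g * contract vs g)) +
      \<alpha> * (\<Sum>k = 0..<m. \<Sum>g\<in>?S. replace k g * (1 * contract vs g))"
    by (simp add: exch_commute [OF v \<alpha>] distrib_right sum.distrib sum_distrib_left mult.assoc)
  \<comment> \<open>The factor 1 is the initial value of \<open>z\<close>. By \<open>D_exch\<close>
    the products of the \<open>\<chi>\<close>'s have derivative 0, so differentiating the contracted
    factors amounts to differentiating the whole pairing.\<close>
  also have "(\<Sum>k = 0..<m. \<Sum>g\<in>?S. replace k g * (1 * contract vs g)) = D (pairing vs)"
    by (subst sum_replace [OF assms(1)]) (simp_all add: pairing_def D_sum D_mult D_exch)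
  finally show ?thesis
    by (simp add: pairing_def sum_product)
qed

end

section \<open>A Fock space representation of the Grassmann algebra\<close>

text \<open>Additive operators on functions of sets of occupied modes. Multiplication by ring
  elements on the left commutes with the creation operators, so these operators contain the
  Grassmann algebra with coefficients in the ring.\<close>

typedef (overloaded) 'a fock_op =
  "{F :: (nat set \<Rightarrow> 'a::ring_1) \<Rightarrow> (nat set \<Rightarrow> 'a). \<forall>f g. F (\<lambda>S. f S + g S) = (\<lambda>S. F f S + F g S)}"
  morphisms fock_apply Fock
  by (rule exI [of _ "\<lambda>f. f"]) simp

setup_lifting type_definition_fock_op

instantiation fock_op :: (ring_1) ring_1
begin

lift_definition zero_fock_op :: "'a fock_op" is "\<lambda>f S. 0" by simp
lift_definition one_fock_op :: "'a fock_op" is "\<lambda>f. f" by simp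
lift_definition plus_fock_op :: "'a fock_op \<Rightarrow> 'a fock_op \<Rightarrow> 'a fock_op"
  is "\<lambda>F G f S. F f S + G f S" by (simp add: algebra_simps)
lift_definition minus_fock_op :: "'a fock_op \<Rightarrow> 'a fock_op \<Rightarrow> 'a fock_op"
  is "\<lambda>F G f S. F f S - G f S" by (simp add: algebra_simps)
lift_definition uminus_fock_op :: "'a fock_op \<Rightarrow> 'a fock_op"
  is "\<lambda>F f S. - F f S" by simp
lift_definition times_fock_op :: "'a fock_op \<Rightarrow> 'a fock_op \<Rightarrow> 'a fock_op"
  is "\<lambda>F G f. F (G f)" by simp

instance
proof
  show "(0::'a fock_op) \<noteq> 1"
    by transfer (metis zero_neq_one)
qed (transfer; simp add: fun_eq_iff algebra_simps)+

end

lift_definition scalar_op :: "'a::ring_1 \<Rightarrow> 'a fock_op" is "\<lambda>r f S. r * f S"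
  by (simp add: distrib_left)

text \<open>The power of -1 is the Jordan-Wigner sign, which makes operators for different modes
  anticommute.\<close>

lift_definition create_op :: "nat \<Rightarrow> 'a::ring_1 fock_op"
  is "\<lambda>i f S. if i \<in> S then (- 1) ^ card {s \<in> S. s < i} * f (S - {i}) else 0"
  by (auto simp: distrib_left fun_eq_iff)

lemma scalar_op_hom:
  "scalar_op (r + s) = scalar_op r + scalar_op s"
  "scalar_op (r * s) = scalar_op r * scalar_op s"
  "scalar_op 1 = 1"
  by (transfer; simp add: fun_eq_iff distrib_right mult.assoc)+

lemma neg_one_power_commute: "(- 1) ^ k * x = x * (- 1) ^ k" for x :: "'a::ring_1"
  by (cases "even k") simp_all

lemma create_op_scalar_op: "create_op i * scalar_op r = scalar_op r * create_op i"
  by transfer (auto simp: fun_eq_iff neg_one_power_commute mult.assoc)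

lemma create_op_square: "create_op i * create_op i = 0"
  by transfer (simp add: fun_eq_iff)

text \<open>For \<open>i < k\<close>, removing \<open>k\<close> leaves the number of modes below
  \<open>i\<close> unchanged, whereas removing \<open>i\<close> lowers the number of modes below
  \<open>k\<close> by one. Exactly one of the two exponents shifts.\<close>

lemma create_op_anticommute: "create_op i * create_op k = - (create_op k * create_op i)"
proof -
  have sign: "(- 1) ^ a * ((- 1) ^ b * x) = - ((- 1) ^ Suc b * ((- 1) ^ a * x))" for a b and x :: 'a
    by (cases "even a"; cases "even b") simp_all
  have less: "create_op i * create_op k = - (create_op k * create_op i :: 'a fock_op)"
    if "i < k" for i k
  proof (transfer fixing: i k, intro ext)
    fix f :: "nat set \<Rightarrow> 'a" and S
    have "{s \<in> S - {k}. s < i} = {s \<in> S. s < i}"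
      using that by auto
    moreover have "card {s \<in> S. s < k} = Suc (card {s \<in> S - {i}. s < k})" if "i \<in> S"
    proof -
      have "{s \<in> S. s < k} = insert i {s \<in> S - {i}. s < k}"
        using \<open>i < k\<close> \<open>i \<in> S\<close> by auto
      then show ?thesis by simp
    qed
    moreover have "S - {i} - {k} = S - {k} - {i}" by auto
    ultimately show "(if i \<in> S then (- 1) ^ card {s \<in> S. s < i} *
          (if k \<in> S - {i} then (- 1) ^ card {s \<in> S - {i}. s < k} * f (S - {i} - {k}) else 0) else 0) =
        - (if k \<in> S then (- 1) ^ card {s \<in> S. s < k} *
          (if i \<in> S - {k} then (- 1) ^ card {s \<in> S - {k}. s < i} * f (S - {k} - {i}) else 0) else 0)"
      using sign [of "card {s \<in> S. s < i}" "card {s \<in> S - {i}. s < k}" "f (S - {k} - {i})"] that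
      by auto
  qed
  consider "i < k" | "i = k" | "k < i" by linarith
  then show ?thesis
    by cases (use less [of i k] less [of k i] in \<open>auto simp: create_op_square\<close>)
qed

lemma fock_apply_one: "fock_apply 1 f = f"
  by transfer simp

lemma fock_apply_mult: "fock_apply (F * G) f = fock_apply F (fock_apply G f)"
  by transfer simp

text \<open>Each operator in turn removes the least mode still present, so no occupied mode lies
  below it and every sign is 1.\<close>

lemma fock_apply_create_ops:
  "k \<le> n \<Longrightarrow> fock_apply (prod_list (map create_op [k..<n])) f {k..<n} = f {}"
proof (induction "n - k" arbitrary: k)
  case 0
  then show ?case by (simp add: fock_apply_one)
next
  case (Suc d)
  then have k: "k < n" by simp
  have empty: "card {s. k \<le> s \<and> s < n \<and> s < k} = 0"
    by auto
  have "{k..<n} - {k} = {Suc k..<n}"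
    by auto
  then show ?case
    using k Suc.hyps(1) [of "Suc k"] Suc.hyps(2)
    by (simp add: upt_conv_Cons empty fock_apply_mult create_op.rep_eq)
qed

text \<open>Extraction of the coefficient of eta_1 ... eta_n: applied to the constant function 1 and
  read at the full set of modes, the operator returns its scalar.\<close>

lemma create_ops_scalar_op_inject:
  assumes "prod_list (map create_op [0..<n]) * scalar_op r = prod_list (map create_op [0..<n]) * scalar_op s"
  shows "r = s"
proof -
  let ?f = "\<lambda>S::nat set. 1 :: 'a"
  have "fock_apply (prod_list (map create_op [0..<n]) * scalar_op t) ?f {0..<n} = t" for t
    by (subst fock_apply_mult, subst fock_apply_create_ops) (simp_all add: scalar_op.rep_eq)
  then show ?thesis
    using assms by metis
qed

lemma fps_mult_commute:
  fixes f g :: "'s::ring_1 fps"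
  assumes "\<And>i j. fps_nth f i * fps_nth g j = fps_nth g j * fps_nth f i"
  shows "f * g = g * f"
proof (rule fps_ext)
  fix k
  have "fps_nth (f * g) k = (\<Sum>i = 0..k. fps_nth g (k - i) * fps_nth f i)"
    by (simp add: fps_mult_nth assms)
  also have "\<dots> = fps_nth (g * f) k"
    unfolding fps_mult_nth by (rule sum.reindex_bij_witness [of _ "\<lambda>i. k - i" "\<lambda>i. k - i"]) auto
  finally show "fps_nth (f * g) k = fps_nth (g * f) k" .
qed

lemma sum_antisymmetric:
  fixes T :: "nat \<Rightarrow> nat \<Rightarrow> 'b::ab_group_add"
  assumes "\<And>i k. T i k = - T k i" and "\<And>i. T i i = 0"
  shows "(\<Sum>i = 0..<n. \<Sum>k = 0..<n. T i k) = 0"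
proof (induction n)
  case (Suc n)
  have "(\<Sum>i = 0..<n. T i n) = - (\<Sum>k = 0..<n. T n k)"
    unfolding sum_negf [symmetric] by (intro sum.cong refl assms(1))
  then show ?case by (simp add: sum.distrib Suc assms(2))
qed simp

lemma scalar_op_zero [simp]: "scalar_op 0 = 0"
  using scalar_op_hom(1) [of 0 0] by simp

lemma scalar_op_minus: "scalar_op (- r) = - scalar_op r"
  using scalar_op_hom(1) [of r "- r"] by (simp add: eq_neg_iff_add_eq_0 add.commute)

lemma scalar_op_diff: "scalar_op (r - s) = scalar_op r - scalar_op s"
  using scalar_op_hom(1) [of r "- s"] by (simp add: scalar_op_minus)

lemma scalar_op_sum: "scalar_op (sum f S) = (\<Sum>x\<in>S. scalar_op (f x))"
  by (induction S rule: infinite_finite_induct) (simp_all add: scalar_op_hom)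

lemma scalar_op_of_nat [simp]: "scalar_op (of_nat k) = of_nat k"
  by (induction k) (simp_all add: scalar_op_hom)

lemma scalar_op_of_int [simp]: "scalar_op (of_int k) = of_int k"
  by (cases k rule: int_cases2) (simp_all add: scalar_op_minus)

interpretation create: anticommuting create_op
  by unfold_locales (rule create_op_anticommute, rule create_op_square)

lemma wedge_create_op_scalar_op:
  "create.wedge is * scalar_op r = scalar_op r * create.wedge is"
proof (induction "is")
  case (Cons i "is")
  then have "create_op i * create.wedge is * scalar_op r = create_op i * scalar_op r * create.wedge is"
    by (simp add: mult.assoc)
  then show ?case by (simp add: create_op_scalar_op mult.assoc)
qed simp

section \<open>One-forms with coefficients in the ring\<close>

definition one_form :: "nat \<Rightarrow> (nat \<Rightarrow> 'a::ring_1) \<Rightarrow> 'a fock_op" where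
  "one_form n u = (\<Sum>i = 0..<n. create_op i * scalar_op (u i))"

lemma one_form_mult:
  "one_form n u * one_form n v =
    (\<Sum>i = 0..<n. \<Sum>k = 0..<n. create_op i * create_op k * scalar_op (u i * v k))"
proof -
  have "create_op i * scalar_op a * (create_op k * scalar_op b) =
      create_op i * create_op k * scalar_op (a * b)" for i k and a b :: 'a
  proof -
    have "create_op i * scalar_op a * (create_op k * scalar_op b) =
        create_op i * (scalar_op a * create_op k) * scalar_op b"
      by (simp add: mult.assoc)
    then show ?thesis
      by (simp add: scalar_op_hom mult.assoc flip: create_op_scalar_op)
  qed
  then show ?thesis
    by (simp add: one_form_def sum_product)
qed

lemma sum_create_op_symmetric:
  assumes "\<And>i k. S i k = S k i"
  shows "(\<Sum>i = 0..<n. \<Sum>k = 0..<n. create_op i * create_op k * scalar_op (S i k)) = 0"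
proof (rule sum_antisymmetric)
  fix i k
  show "create_op i * create_op k * scalar_op (S i k) = - (create_op k * create_op i * scalar_op (S k i))"
    by (simp add: create_op_anticommute [of i k] assms [of i k])
qed (simp add: create_op_square)

text \<open>The anticommutator has the commutators of \<open>u i\<close> and \<open>v k\<close> as
  coefficients of \<open>create_op i * create_op k\<close>. The assumption says that they are
  symmetric in \<open>i\<close> and \<open>k\<close>, and symmetric coefficients cancel against
  anticommuting operators.\<close>

lemma one_form_anticommute:
  assumes "\<And>i k. u i * v k - v k * u i = u k * v i - v i * u k"
  shows "one_form n u * one_form n v = - (one_form n v * one_form n u)"
proof -
  have "one_form n v * one_form n u =
      (\<Sum>i = 0..<n. \<Sum>k = 0..<n. create_op k * create_op i * scalar_op (v k * u i))"
    unfolding one_form_mult by (rule sum.swap)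
  also have "\<dots> = - (\<Sum>i = 0..<n. \<Sum>k = 0..<n. create_op i * create_op k * scalar_op (v k * u i))"
    unfolding sum_negf [symmetric]
    by (intro sum.cong refl) (metis create_op_anticommute mult_minus_left)
  finally have "one_form n u * one_form n v + one_form n v * one_form n u =
      (\<Sum>i = 0..<n. \<Sum>k = 0..<n. create_op i * create_op k * scalar_op (u i * v k - v k * u i))"
    by (simp add: one_form_mult scalar_op_diff right_diff_distrib sum_subtractf)
  also have "\<dots> = 0"
    by (rule sum_create_op_symmetric) (rule assms)
  finally show ?thesis by (simp add: eq_neg_iff_add_eq_0)
qed

lemma one_form_square:
  assumes "\<And>i k. u i * u k = u k * u i"
  shows "one_form n u * one_form n u = 0"
  unfolding one_form_mult by (rule sum_create_op_symmetric) (rule assms)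

lemma prod_list_one_form:
  "prod_list (map (\<lambda>j. one_form n (\<lambda>i. u i j)) js) =
    (\<Sum>is | set is \<subseteq> {0..<n} \<and> length is = length js.
      create.wedge is * scalar_op (prod_list (map2 u is js)))"
proof (induction js)
  case Nil
  then show ?case by (simp add: scalar_op_hom cong: conj_cong)
next
  case (Cons j js)
  have "create_op i * scalar_op a * (w * scalar_op b) = create_op i * w * scalar_op (a * b)"
    if "w = create.wedge is" for i "is" w and a b :: 'a
  proof -
    have "create_op i * scalar_op a * (w * scalar_op b) = create_op i * (scalar_op a * w) * scalar_op b"
      by (simp add: mult.assoc)
    then show ?thesis
      by (simp add: that scalar_op_hom mult.assoc flip: wedge_create_op_scalar_op)
  qed
  then show ?case
    by (simp add: Cons.IH sum_lists_Suc, subst one_form_def, simp add: sum_product)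
qed

section \<open>The Cauchy-Binet identity as a coefficient of a formal power series\<close>

locale capelli =
  fixes n m :: nat and X Y A B :: "nat \<Rightarrow> nat \<Rightarrow> 'a::ring_1"
  assumes B_central: "B i j * r = r * B i j"
    and X_Y: "X i j * Y k l - Y k l * X i j = - (A i l * B k j)"
    and X_X: "X i j * X k l - X k l * X i j = X k j * X i l - X i l * X k j"
    and X_col: "X i j * X k j = X k j * X i j"
    and X_A: "X i j * A k l - A k l * X i j = X k j * A i l - A i l * X k j"
begin

fun Bpow :: "nat \<Rightarrow> nat \<Rightarrow> nat \<Rightarrow> 'a" where
  "Bpow 0 k j = (if k = j then 1 else 0)"
| "Bpow (Suc r) k j = (\<Sum>i = 0..<m. Bpow r k i * B i j)"

lemma Bpow_central: "Bpow r k j * x = x * Bpow r k j"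
proof (induction r arbitrary: j)
  case (Suc r)
  have "Bpow r k i * B i j * x = x * (Bpow r k i * B i j)" for i
    by (metis B_central Suc.IH mult.assoc)
  then show ?case by (simp add: sum_distrib_left sum_distrib_right)
qed simp

lemma Bpow_add:
  "j < m \<Longrightarrow> (\<Sum>i = 0..<m. Bpow (Suc r) k i * Bpow s i j) = Bpow (Suc (r + s)) k j"
proof (induction s arbitrary: j)
  case 0
  have "(\<Sum>i = 0..<m. Bpow (Suc r) k i * Bpow 0 i j) =
      (\<Sum>i = 0..<m. if i = j then Bpow (Suc r) k i else 0)"
    by (rule sum.cong) (auto simp del: Bpow.simps(2))
  then show ?case
    using 0 by (simp del: Bpow.simps)
next
  case (Suc s)
  have "(\<Sum>i = 0..<m. Bpow (Suc r) k i * Bpow (Suc s) i j) =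
      (\<Sum>h = 0..<m. (\<Sum>i = 0..<m. Bpow (Suc r) k i * Bpow s i h) * B h j)"
    unfolding Bpow.simps(2) [of s] sum_distrib_left sum_distrib_right
    by (subst sum.swap) (simp add: mult.assoc del: Bpow.simps)
  also have "\<dots> = Bpow (Suc (r + Suc s)) k j"
    by (simp only: Bpow.simps(2) [of "Suc (r + s)"] add_Suc_right)
      (intro sum.cong refl, simp add: Suc.IH del: Bpow.simps)
  finally show ?case .
qed

text \<open>\<open>W r\<close> is the coefficient matrix of \<open>t\<^sup>r\<close> in \<open>(1 - tB)\<^sup>-\<^sup>1 Y\<close>.\<close>

definition W :: "nat \<Rightarrow> nat \<Rightarrow> nat \<Rightarrow> 'a" where
  "W r k l = (\<Sum>j = 0..<m. Bpow r k j * Y j l)"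

lemma W_0: "k < m \<Longrightarrow> W 0 k l = Y k l"
  by (simp add: W_def if_distrib [of "\<lambda>x. x * _"] cong: if_cong)

lemma W_Bpow: "(\<Sum>j = 0..<m. Bpow (Suc r) k j * W s j l) = W (Suc (r + s)) k l"
proof -
  have "(\<Sum>j = 0..<m. Bpow (Suc r) k j * W s j l) =
      (\<Sum>i = 0..<m. (\<Sum>j = 0..<m. Bpow (Suc r) k j * Bpow s j i) * Y i l)"
    unfolding W_def sum_distrib_left sum_distrib_right
    by (subst sum.swap) (simp add: mult.assoc del: Bpow.simps)
  also have "\<dots> = W (Suc (r + s)) k l"
    unfolding W_def by (intro sum.cong refl) (simp add: Bpow_add del: Bpow.simps)
  finally show ?thesis .
qed

text \<open>The central \<open>Bpow r k h\<close> comes out of the commutator, and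
  \<open>X_Y\<close> contributes one more factor \<open>B h j\<close>; the sum over \<open>h\<close>
  therefore raises the power from \<open>r\<close> to \<open>Suc r\<close>.\<close>

lemma X_W: "X i j * W r k l - W r k l * X i j = - (A i l * Bpow (Suc r) k j)"
proof -
  have "X i j * (Bpow r k h * Y h l) - Bpow r k h * Y h l * X i j = - (A i l * (Bpow r k h * B h j))" for h
  proof -
    have "X i j * (Bpow r k h * Y h l) - Bpow r k h * Y h l * X i j =
        Bpow r k h * (X i j * Y h l - Y h l * X i j)"
      by (simp add: right_diff_distrib mult.assoc)
        (simp add: Bpow_central [of r k h "X i j", symmetric] flip: mult.assoc)
    also have "\<dots> = - (A i l * (Bpow r k h * B h j))"
      by (simp add: X_Y Bpow_central [of r k h "A i l"] flip: mult.assoc)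
    finally show ?thesis .
  qed
  then show ?thesis
    by (simp add: W_def sum_distrib_left sum_distrib_right flip: sum_subtractf sum_negf)
qed

text \<open>The coefficient of $t^p$ in the product of the entries with rows \<open>is\<close> and columns \<open>ls\<close> of
  $A\,d/dt + X(1-tB)^{-1}Y$, applied to the constant series 1.\<close>

fun osc_coeff :: "nat \<Rightarrow> nat list \<Rightarrow> nat list \<Rightarrow> 'a" where
  "osc_coeff p (i # is) (l # ls) = of_nat (Suc p) * (A i l * osc_coeff (Suc p) is ls) +
     (\<Sum>r = 0..p. (\<Sum>j = 0..<m. X i j * W r j l) * osc_coeff (p - r) is ls)"
| "osc_coeff p _ _ = (if p = 0 then 1 else 0)"

definition \<chi> :: "nat \<Rightarrow> 'a fock_op" where
  "\<chi> j = one_form n (\<lambda>i. X i j)"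

definition \<alpha> :: "nat \<Rightarrow> 'a fock_op" where
  "\<alpha> l = one_form n (\<lambda>i. A i l)"

text \<open>The matrix B (1 - tB)^{-1}: the coefficient of t^r is B^(r+1).\<close>

definition \<beta> :: "nat \<Rightarrow> nat \<Rightarrow> 'a fock_op fps" where
  "\<beta> k j = Abs_fps (\<lambda>r. scalar_op (Bpow (Suc r) k j))"

definition v :: "nat \<Rightarrow> nat \<Rightarrow> 'a fock_op fps" where
  "v l k = Abs_fps (\<lambda>r. scalar_op (W r k l))"

sublocale chi: anticommuting \<chi>
proof
  show "\<chi> j * \<chi> l = - (\<chi> l * \<chi> j)" for j l
    unfolding \<chi>_def by (rule one_form_anticommute) (rule X_X)
  show "\<chi> j * \<chi> j = 0" for j
    unfolding \<chi>_def by (rule one_form_square) (rule X_col)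
qed

lemma \<chi>_\<alpha>: "\<chi> j * \<alpha> l = - (\<alpha> l * \<chi> j)"
  unfolding \<chi>_def \<alpha>_def by (rule one_form_anticommute) (rule X_A)

lemma Bpow_one_form:
  "scalar_op (Bpow r k j) * one_form n u = one_form n u * scalar_op (Bpow r k j)"
  unfolding one_form_def sum_distrib_left sum_distrib_right
proof (rule sum.cong)
  fix i
  have "scalar_op (Bpow r k j) * (create_op i * scalar_op (u i)) =
      create_op i * (scalar_op (Bpow r k j) * scalar_op (u i))"
    by (metis create_op_scalar_op mult.assoc)
  also have "scalar_op (Bpow r k j) * scalar_op (u i) = scalar_op (u i) * scalar_op (Bpow r k j)"
    by (simp only: Bpow_central flip: scalar_op_hom(2))
  finally show "scalar_op (Bpow r k j) * (create_op i * scalar_op (u i)) =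
      create_op i * scalar_op (u i) * scalar_op (Bpow r k j)"
    by (simp add: mult.assoc)
qed simp

lemma \<chi>_v: "fps_const (\<chi> j) * v l k = v l k * fps_const (\<chi> j) - fps_const (\<alpha> l) * \<beta> k j"
proof (rule fps_ext)
  fix r
  have "create_op i * scalar_op (X i j) * scalar_op (W r k l) =
      scalar_op (W r k l) * (create_op i * scalar_op (X i j))
      - create_op i * scalar_op (A i l) * scalar_op (Bpow (Suc r) k j)" for i
  proof -
    have "X i j * W r k l = W r k l * X i j - A i l * Bpow (Suc r) k j"
      using X_W [of i j r k l] by (simp add: algebra_simps del: Bpow.simps)
    then have "create_op i * scalar_op (X i j) * scalar_op (W r k l) =
        create_op i * (scalar_op (W r k l) * scalar_op (X i j))
        - create_op i * (scalar_op (A i l) * scalar_op (Bpow (Suc r) k j))"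
      by (simp add: mult.assoc scalar_op_diff right_diff_distrib del: Bpow.simps flip: scalar_op_hom(2))
    also have "create_op i * (scalar_op (W r k l) * scalar_op (X i j)) =
        scalar_op (W r k l) * (create_op i * scalar_op (X i j))"
      by (metis create_op_scalar_op mult.assoc)
    finally show ?thesis by (simp add: mult.assoc)
  qed
  then show "fps_nth (fps_const (\<chi> j) * v l k) r =
      fps_nth (v l k * fps_const (\<chi> j) - fps_const (\<alpha> l) * \<beta> k j) r"
    by (simp add: v_def \<beta>_def \<chi>_def \<alpha>_def one_form_def sum_distrib_left sum_distrib_right
        del: Bpow.simps flip: sum_subtractf)
qed

text \<open>At t^r each of the r + 1 splittings of the product on the right gives the same B^(r+1)
  y_l. Their number is the factor that differentiation brings down from t^(r+1).\<close>

lemma deriv_v: "fps_deriv (v l k) = (\<Sum>j = 0..<m. \<beta> k j * v l j)"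
proof (rule fps_ext)
  fix r
  have "fps_nth (\<Sum>j = 0..<m. \<beta> k j * v l j) r =
      (\<Sum>s = 0..r. scalar_op (\<Sum>j = 0..<m. Bpow (Suc s) k j * W (r - s) j l))"
    by (simp add: fps_sum_nth fps_mult_nth \<beta>_def v_def scalar_op_sum scalar_op_hom del: Bpow.simps)
      (rule sum.swap)
  also have "\<dots> = of_nat (Suc r) * scalar_op (W (Suc r) k l)"
    by (simp add: W_Bpow del: Bpow.simps)
  finally show "fps_nth (fps_deriv (v l k)) r = fps_nth (\<Sum>j = 0..<m. \<beta> k j * v l j) r"
    by (simp add: v_def)
qed

sublocale oscillator: derivation_family m "\<lambda>j. fps_const (\<chi> j)" \<beta> fps_deriv "range v"
proof
  show "fps_const (\<chi> j) * fps_const (\<chi> k) = - (fps_const (\<chi> k) * fps_const (\<chi> j))" for j k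
    by (simp add: chi.anticommute [of j k])
  show "\<beta> j k * fps_const (\<chi> i) = fps_const (\<chi> i) * \<beta> j k" for i j k
    by (rule fps_mult_commute) (auto simp: \<beta>_def \<chi>_def Bpow_one_form simp del: Bpow.simps)
  show "\<beta> j k * u i = u i * \<beta> j k" if "u \<in> range v" for u i j k
  proof (rule fps_mult_commute)
    fix r s
    from that obtain l where "u = v l" by blast
    then show "fps_nth (\<beta> j k) r * fps_nth (u i) s = fps_nth (u i) s * fps_nth (\<beta> j k) r"
      by (simp add: \<beta>_def v_def del: Bpow.simps flip: scalar_op_hom(2))
        (simp only: Bpow_central)
  qed
  show "fps_deriv (u k) = (\<Sum>j = 0..<m. \<beta> k j * u j)" if "u \<in> range v" for u k
    using that deriv_v by blast
qed simp_all

text \<open>By \<open>pairing_Cons\<close> a further column applies one operator. Its derivative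
  part shifts the coefficient index up and brings the factor \<open>Suc p\<close>, and its
  multiplication part is a convolution. Scalars pass the creation operators, so each term separates
  into a wedge and a product in the ring whose order is kept; \<open>osc_coeff\<close> records that
  product.\<close>

lemma fps_nth_pairing:
  "fps_nth (oscillator.pairing (map v ls)) p =
    (\<Sum>is | set is \<subseteq> {0..<n} \<and> length is = length ls. create.wedge is * scalar_op (osc_coeff p is ls))"
proof (induction ls arbitrary: p)
  case Nil
  then show ?case
    by (simp add: oscillator.pairing_def scalar_op_hom cong: conj_cong)
next
  case (Cons l ls)
  let ?S = "{is. set is \<subseteq> {0..<n} \<and> length is = length ls}"
  let ?P = "oscillator.pairing (map v ls)"
  have commute: "create_op i * scalar_op a * (create.wedge is * scalar_op b) =
      create_op i * create.wedge is * scalar_op (a * b)" for i "is" and a b :: 'a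
    by (metis mult.assoc scalar_op_hom(2) wedge_create_op_scalar_op)
  have \<alpha>_term: "\<alpha> l * fps_nth (fps_deriv ?P) p = (\<Sum>i = 0..<n. \<Sum>is\<in>?S. create.wedge (i # is) *
      scalar_op (of_nat (Suc p) * (A i l * osc_coeff (Suc p) is ls)))"
  proof -
    have pull: "of_nat q * (w * scalar_op a) = w * scalar_op (of_nat q * a)" for q w and a :: 'a
      by (metis mult.assoc mult_of_nat_commute scalar_op_hom(2) scalar_op_of_nat)
    have "\<alpha> l * fps_nth (fps_deriv ?P) p = of_nat (Suc p) * (\<alpha> l * fps_nth ?P (Suc p))"
      by (simp add: mult_of_nat_commute mult.assoc del: of_nat_Suc)
    also have "\<alpha> l * fps_nth ?P (Suc p) = (\<Sum>i = 0..<n. \<Sum>is\<in>?S.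
        create.wedge (i # is) * scalar_op (A i l * osc_coeff (Suc p) is ls))"
      by (simp add: Cons.IH \<alpha>_def one_form_def sum_product commute)
    also have "of_nat (Suc p) * \<dots> = (\<Sum>i = 0..<n. \<Sum>is\<in>?S. of_nat (Suc p) *
        (create.wedge (i # is) * scalar_op (A i l * osc_coeff (Suc p) is ls)))"
      by (simp only: sum_distrib_left)
    finally show ?thesis by (simp only: pull)
  qed
  have \<chi>_term: "fps_nth ((\<Sum>k = 0..<m. fps_const (\<chi> k) * v l k)) r =
      (\<Sum>i = 0..<n. create_op i * scalar_op (\<Sum>j = 0..<m. X i j * W r j l))" for r
    unfolding fps_sum_nth scalar_op_sum sum_distrib_left
    by (subst sum.swap)
      (simp add: v_def \<chi>_def one_form_def sum_distrib_right scalar_op_hom mult.assoc)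
  have "fps_nth ((\<Sum>k = 0..<m. fps_const (\<chi> k) * v l k) * ?P) p =
      (\<Sum>r = 0..p. \<Sum>i = 0..<n. \<Sum>is\<in>?S. create.wedge (i # is) *
        scalar_op ((\<Sum>j = 0..<m. X i j * W r j l) * osc_coeff (p - r) is ls))"
    by (simp add: fps_mult_nth \<chi>_term Cons.IH sum_product commute)
  also have "\<dots> = (\<Sum>i = 0..<n. \<Sum>is\<in>?S. \<Sum>r = 0..p. create.wedge (i # is) *
        scalar_op ((\<Sum>j = 0..<m. X i j * W r j l) * osc_coeff (p - r) is ls))"
    by (subst sum.swap, intro sum.cong refl, rule sum.swap)
  also have "\<dots> = (\<Sum>i = 0..<n. \<Sum>is\<in>?S. create.wedge (i # is) *
        scalar_op (\<Sum>r = 0..p. (\<Sum>j = 0..<m. X i j * W r j l) * osc_coeff (p - r) is ls))"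
    by (simp only: scalar_op_sum sum_distrib_left)
  finally have \<chi>_sum: "fps_nth ((\<Sum>k = 0..<m. fps_const (\<chi> k) * v l k) * ?P) p = \<dots>" .
  have "oscillator.pairing (map v (l # ls)) =
      (\<Sum>k = 0..<m. fps_const (\<chi> k) * v l k) * ?P + fps_const (\<alpha> l) * fps_deriv ?P"
    unfolding list.map by (rule oscillator.pairing_Cons [OF _ \<chi>_v]) (auto simp: \<chi>_\<alpha>)
  then have "fps_nth (oscillator.pairing (map v (l # ls))) p =
      fps_nth ((\<Sum>k = 0..<m. fps_const (\<chi> k) * v l k) * ?P) p + \<alpha> l * fps_nth (fps_deriv ?P) p"
    by simp
  also have "\<dots> = (\<Sum>i = 0..<n. \<Sum>is\<in>?S. create.wedge (i # is) * scalar_op (osc_coeff p (i # is) (l # ls)))"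
    unfolding \<chi>_sum \<alpha>_term
    by (simp add: scalar_op_hom(1) distrib_left sum.distrib add.commute del: of_nat_Suc)
  finally show ?case
    by (simp add: sum_lists_Suc)
qed

lemma exch_const: "oscillator.exch g = fps_const (chi.wedge g)"
  by (induction g) simp_all

lemma contract_v_0:
  "length g = length ls \<Longrightarrow> set g \<subseteq> {0..<m} \<Longrightarrow>
    fps_nth (contract (map v ls) g) 0 = scalar_op (prod_list (map2 Y g ls))"
proof (induction g arbitrary: ls)
  case (Cons k g)
  then show ?case
    by (cases ls) (simp_all add: v_def W_0 scalar_op_hom)
qed (simp add: scalar_op_hom)

text \<open>The constant term of the pairing is computed in two ways. Directly, at t = 0 the series
  \<open>v\<close> reduce to Y, and \<open>chi.sum_wedge\<close> produces the sum over subsets. By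
  \<open>fps_nth_pairing\<close>, the recursion produces the oscillator coefficients.\<close>

theorem cauchy_binet_core:
  "(\<Sum>L | L \<subseteq> {0..<m} \<and> card L = n.
      (\<Sum>\<sigma> | \<sigma> permutes {0..<n}. of_int (sign \<sigma>) *
        prod_list (map (\<lambda>j. X (\<sigma> j) (sorted_list_of_set L ! j)) [0..<n])) *
      (\<Sum>\<sigma> | \<sigma> permutes {0..<n}. of_int (sign \<sigma>) *
        prod_list (map (\<lambda>j. Y (sorted_list_of_set L ! \<sigma> j) j) [0..<n]))) =
    (\<Sum>\<sigma> | \<sigma> permutes {0..<n}. of_int (sign \<sigma>) * osc_coeff 0 (map \<sigma> [0..<n]) [0..<n])"
    (is "?lhs = ?rhs")
proof (rule create_ops_scalar_op_inject)
  have map2_map: "map2 f (map \<sigma> xs) xs = map (\<lambda>j. f (\<sigma> j) j) xs" for f :: "nat \<Rightarrow> nat \<Rightarrow> 'a" and \<sigma> xs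
    by (induction xs) simp_all
  let ?l = sorted_list_of_set
  let ?w = "create.wedge [0..<n]"
  \<comment> \<open>A product of \<open>n\<close> one-forms in \<open>n\<close> modes has top
    degree. Its single coefficient is the column determinant of the columns of X in
    \<open>L\<close>.\<close>
  have chi_wedge: "chi.wedge (?l L) = ?w * scalar_op (\<Sum>\<sigma> | \<sigma> permutes {0..<n}. of_int (sign \<sigma>) *
        prod_list (map (\<lambda>j. X (\<sigma> j) (?l L ! j)) [0..<n]))"
    if "card L = n" for L
  proof -
    have "map2 X (map \<sigma> [0..<n]) (?l L) = map (\<lambda>j. X (\<sigma> j) (?l L ! j)) [0..<n]" for \<sigma>
      using that by (intro nth_equalityI) auto
    then show ?thesis
      using that unfolding chi.wedge_def \<chi>_def prod_list_one_form
      by (simp add: sum_wedge_full [OF create.anticommuting_axioms] scalar_op_sum scalar_op_hom(2))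
  qed
  have pairing_0: "fps_nth (oscillator.pairing (map v [0..<n])) 0 =
      (\<Sum>g | set g \<subseteq> {0..<m} \<and> length g = n. chi.wedge g * scalar_op (prod_list (map2 Y g [0..<n])))"
    unfolding oscillator.pairing_def fps_sum_nth
    by (rule sum.cong) (auto simp: exch_const contract_v_0)
  have "?w * scalar_op ?lhs = (\<Sum>L | L \<subseteq> {0..<m} \<and> card L = n. chi.wedge (?l L) *
      scalar_op (\<Sum>\<sigma> | \<sigma> permutes {0..<n}. of_int (sign \<sigma>) *
        prod_list (map (\<lambda>j. Y (?l L ! \<sigma> j) j) [0..<n])))"
    unfolding scalar_op_sum [of _ "{L. L \<subseteq> {0..<m} \<and> card L = n}"] sum_distrib_left [of ?w]
    by (rule sum.cong) (simp_all add: chi_wedge scalar_op_hom(2) mult.assoc)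
  also have "\<dots> = fps_nth (oscillator.pairing (map v [0..<n])) 0"
  proof -
    have "map2 Y (permute_list \<tau> (?l L)) [0..<n] = map (\<lambda>j. Y (?l L ! \<tau> j) j) [0..<n]"
      if "card L = n" for \<tau> L
      using that by (intro nth_equalityI) (auto simp: permute_list_def)
    then show ?thesis
      unfolding pairing_0 chi.sum_wedge
      by (intro sum.cong refl) (auto simp: scalar_op_sum scalar_op_hom(2))
  qed
  also have "\<dots> = ?w * scalar_op ?rhs"
    by (simp add: fps_nth_pairing sum_wedge_full [OF create.anticommuting_axioms] scalar_op_sum
        scalar_op_hom(2))
  finally show "prod_list (map create_op [0..<n]) * scalar_op ?lhs =
      prod_list (map create_op [0..<n]) * scalar_op ?rhs"
    by (simp add: create.wedge_def)
qed

end

section \<open>Evaluation of oscillator series\<close>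

text \<open>Extension by zero makes the relations of \<open>capelli\<close> hold for all natural
  indices: when an index is out of range, both sides vanish.\<close>

definition matrix_fun :: "'a::zero mat \<Rightarrow> nat \<Rightarrow> nat \<Rightarrow> 'a" where
  "matrix_fun M i j = (if i < dim_row M \<and> j < dim_col M then M $$ (i,j) else 0)"

lemma finite_osc_words: "finite {w :: osc list. length w \<le> K}"
proof -
  have "(UNIV :: osc set) = {Ann, Cre}" using osc.exhaust by blast
  then have "finite (UNIV :: osc set)" by (metis finite.emptyI finite.insertI)
  from finite_lists_length_le [OF this, of K] show ?thesis by simp
qed

text \<open>The coefficient of \<open>x\<^sup>p\<close> in the series applied to 1, truncated to words of length at most
  \<open>K\<close> so that the sum is finite for every series.\<close>

definition coeff_upto :: "nat \<Rightarrow> nat \<Rightarrow> 'a::ring_1 osc_series \<Rightarrow> 'a" where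
  "coeff_upto K p f = (\<Sum>w | length w \<le> K. scoeff f w * of_int (coeff (foldr osc_act w 1) p))"

lemma scoeff_sum [simp]: "scoeff (sum f S) w = (\<Sum>x\<in>S. scoeff (f x) w)"
  by (induction S rule: infinite_finite_induct) simp_all

lemma coeff_upto_sum: "coeff_upto K p (sum f S) = (\<Sum>x\<in>S. coeff_upto K p (f x))"
  unfolding coeff_upto_def scoeff_sum sum_distrib_right by (rule sum.swap)

lemma coeff_upto_sign: "coeff_upto K p (of_int (sign \<sigma>) * f) = of_int (sign \<sigma>) * coeff_upto K p f"
  by (cases \<sigma> rule: sign_cases) (simp_all add: coeff_upto_def sum_negf)

lemma coeff_upto_one: "coeff_upto K p 1 = (if p = 0 then 1 else 0)"
proof -
  have "coeff_upto K p (1 :: 'a osc_series) = (\<Sum>w\<in>{[]}. scoeff 1 w * of_int (coeff (foldr osc_act w 1) p))"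
    unfolding coeff_upto_def using finite_osc_words by (intro sum.mono_neutral_right) auto
  then show ?thesis by simp
qed

text \<open>A word of the product together with a cut is a pair of words, of which the right one
  acts first; it has to fit into the length that the left one leaves over.\<close>

lemma coeff_upto_mult:
  "coeff_upto K p (f * g) = (\<Sum>u | length u \<le> K. \<Sum>v | length v \<le> K - length u.
     scoeff f u * (scoeff g v * of_int (coeff (foldr osc_act u (foldr osc_act v 1)) p)))"
proof -
  let ?F = "\<lambda>u v. scoeff f u * (scoeff g v * of_int (coeff (foldr osc_act u (foldr osc_act v 1)) p))"
  have "coeff_upto K p (f * g) = (\<Sum>w | length w \<le> K. \<Sum>k = 0..length w. ?F (take k w) (drop k w))"
    unfolding coeff_upto_def scoeff_mult sum_distrib_right
    by (simp add: mult.assoc flip: foldr_append)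
  also have "\<dots> = (\<Sum>(w, k) \<in> (SIGMA w:{w. length w \<le> K}. {0..length w}). ?F (take k w) (drop k w))"
    by (subst sum.Sigma) (auto simp: finite_osc_words)
  also have "\<dots> = (\<Sum>(u, v) \<in> (SIGMA u:{u. length u \<le> K}. {v. length v \<le> K - length u}). ?F u v)"
    by (rule sum.reindex_bij_witness
        [of _ "\<lambda>(u, v). (u @ v, length u)" "\<lambda>(w, k). (take k w, drop k w)"]) auto
  also have "\<dots> = (\<Sum>u | length u \<le> K. \<Sum>v | length v \<le> K - length u. ?F u v)"
    by (subst sum.Sigma) (auto simp: finite_osc_words)
  finally show ?thesis .
qed

lemma scoeff_const_mult: "scoeff (osc_const r * f) w = r * scoeff f w"
proof -
  have "scoeff (osc_const r * f) w = (\<Sum>k = 0..length w. if k = 0 then r * scoeff f w else 0)"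
    unfolding scoeff_mult by (rule sum.cong) (auto simp: osc_const_def)
  then show ?thesis by simp
qed

lemma scoeff_mult_const: "scoeff (f * osc_const r) w = scoeff f w * r"
proof -
  have "scoeff (f * osc_const r) w = (\<Sum>k = 0..length w. if k = length w then scoeff f w * r else 0)"
    unfolding scoeff_mult by (rule sum.cong) (auto simp: osc_const_def)
  then show ?thesis by simp
qed

lemma coeff_foldr_Cre:
  "coeff (foldr osc_act (replicate r Cre) q) p = (if r \<le> p then coeff q (p - r) else 0)"
proof (induction r arbitrary: p)
  case (Suc r)
  then show ?case by (cases p) simp_all
qed simp

lemma scoeff_osc_matrix:
  assumes "X \<in> carrier_mat n m" "Y \<in> carrier_mat m n"
    "A \<in> carrier_mat n n" "B \<in> carrier_mat m m" and "i < n" "l < n"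
  shows "scoeff (osc_matrix c d A B X Y $$ (i,l)) u =
    (if u = [c] then A $$ (i,l) else 0) +
    (if u = replicate (length u) d then
       \<Sum>j = 0..<m. X $$ (i,j) * (\<Sum>k = 0..<m. (B ^\<^sub>m length u) $$ (j,k) * Y $$ (k,l)) else 0)"
proof -
  have G: "osc_geometric d B \<in> carrier_mat m m"
    using assms(4) by (simp add: osc_geometric_def)
  have geo: "scoeff (osc_geometric d B $$ (j,k)) u =
      (if u = replicate (length u) d then (B ^\<^sub>m length u) $$ (j,k) else 0)" if "j < m" "k < m" for j k
    using that assms(4) by (simp add: osc_geometric_def)
  have "osc_matrix c d A B X Y $$ (i,l) = osc_gen c * osc_const (A $$ (i,l)) +
      (\<Sum>k = 0..<m. (\<Sum>j = 0..<m. osc_const (X $$ (i,j)) * osc_geometric d B $$ (j,k))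
        * osc_const (Y $$ (k,l)))"
    using assms G unfolding osc_matrix_def by (simp add: scalar_prod_def del: assoc_mult_mat)
  then have "scoeff (osc_matrix c d A B X Y $$ (i,l)) u = (if u = [c] then A $$ (i,l) else 0) +
      (\<Sum>k = 0..<m. \<Sum>j = 0..<m. X $$ (i,j) * scoeff (osc_geometric d B $$ (j,k)) u * Y $$ (k,l))"
    by (simp add: scoeff_mult_const scoeff_const_mult osc_gen_def sum_distrib_right)
  also have "(\<Sum>k = 0..<m. \<Sum>j = 0..<m. X $$ (i,j) * scoeff (osc_geometric d B $$ (j,k)) u * Y $$ (k,l)) =
      (\<Sum>j = 0..<m. \<Sum>k = 0..<m. X $$ (i,j) * (scoeff (osc_geometric d B $$ (j,k)) u * Y $$ (k,l)))"
    by (subst sum.swap) (simp add: mult.assoc)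
  also have "\<dots> = (if u = replicate (length u) d then
       \<Sum>j = 0..<m. X $$ (i,j) * (\<Sum>k = 0..<m. (B ^\<^sub>m length u) $$ (j,k) * Y $$ (k,l)) else 0)"
    by (simp add: geo sum_distrib_left)
  finally show ?thesis .
qed

text \<open>For the coefficient of x^p, \<open>Ann\<close> differentiates and gives p + 1 times the
  next coefficient, while r letters \<open>Cre\<close> lower p by r and leave nothing if r > p. This
  is the recursion of \<open>osc_coeff\<close>. The condition \<open>p < K\<close> keeps
  \<open>[Ann]\<close> and the powers of \<open>Cre\<close> up to p within the truncation.\<close>

lemma coeff_upto_osc_matrix_mult:
  assumes "\<And>u. scoeff f u = (if u = [Ann] then a else 0) +
      (if u = replicate (length u) Cre then b (length u) else 0)"
    and "p < K"
  shows "coeff_upto K p (f * g) = of_nat (Suc p) * (a * coeff_upto (K - 1) (Suc p) g) +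
    (\<Sum>r = 0..p. b r * coeff_upto (K - r) (p - r) g)"
proof -
  define F where "F u = (\<Sum>v | length v \<le> K - length u.
      scoeff g v * of_int (coeff (foldr osc_act u (foldr osc_act v 1)) p))" for u
  have F_Ann: "F [Ann] = of_nat (Suc p) * coeff_upto (K - 1) (Suc p) g"
    by (simp add: F_def coeff_upto_def coeff_pderiv sum_distrib_left mult_of_nat_commute mult.assoc
        del: of_nat_Suc)
  have F_Cre: "F (replicate r Cre) = (if r \<le> p then coeff_upto (K - r) (p - r) g else 0)" for r
    by (simp add: F_def coeff_upto_def coeff_foldr_Cre del: foldr_replicate)
  have "coeff_upto K p (f * g) = (\<Sum>u | length u \<le> K. scoeff f u * F u)"
    by (simp add: coeff_upto_mult F_def sum_distrib_left)
  also have "\<dots> = (\<Sum>u | length u \<le> K. if u = [Ann] then a * F [Ann] else 0) +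
      (\<Sum>u | length u \<le> K. if u = replicate (length u) Cre then b (length u) * F u else 0)"
    unfolding sum.distrib [symmetric]
    by (intro sum.cong refl) (auto simp: assms(1) distrib_right)
  also have "(\<Sum>u | length u \<le> K. if u = [Ann] then a * F [Ann] else 0) = a * F [Ann]"
    using assms(2) finite_osc_words [of K] by (simp add: sum.delta)
  also have "(\<Sum>u | length u \<le> K. if u = replicate (length u) Cre then b (length u) * F u else 0) =
      (\<Sum>u \<in> (\<lambda>r. replicate r Cre) ` {0..p}. b (length u) * F u)"
  proof (rule sum.mono_neutral_cong_right)
    show "\<forall>u \<in> {u. length u \<le> K} - (\<lambda>r. replicate r Cre) ` {0..p}.
        (if u = replicate (length u) Cre then b (length u) * F u else 0) = 0"
    proof
      fix u assume u: "u \<in> {u. length u \<le> K} - (\<lambda>r. replicate r Cre) ` {0..p}"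
      show "(if u = replicate (length u) Cre then b (length u) * F u else 0) = 0"
      proof (cases "u = replicate (length u) Cre")
        case True
        with u have "\<not> length u \<le> p" by (metis DiffD2 atLeastAtMost_iff image_eqI zero_le)
        then have "F u = 0" using F_Cre [of "length u"] True by simp
        then show ?thesis by simp
      qed simp
    qed
  qed (use assms(2) finite_osc_words in auto)
  also have "\<dots> = (\<Sum>r = 0..p. b r * F (replicate r Cre))"
    by (subst sum.reindex) (auto intro!: inj_onI dest: arg_cong [of _ _ length])
  finally show ?thesis
    by (simp add: F_Ann F_Cre mult_of_nat_commute mult.assoc del: of_nat_Suc)
qed

context capelli
begin

text \<open>A word from N entries has at most N letters \<open>Ann\<close>, hence at most N + p
  letters \<open>Cre\<close> if it contributes to x^p; this gives the length 2 N + p. In the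
  recursion, \<open>Ann\<close> lowers \<open>K\<close> by one and raises \<open>p\<close> by one,
  which uses up the two units reserved for its factor.\<close>

lemma coeff_upto_prod_list:
  assumes "\<And>i l u. i < n \<Longrightarrow> l < n \<Longrightarrow> scoeff (M i l) u = (if u = [Ann] then A i l else 0) +
      (if u = replicate (length u) Cre then \<Sum>j = 0..<m. X i j * W (length u) j l else 0)"
    and "length is = length ls" "set is \<subseteq> {0..<n}" "set ls \<subseteq> {0..<n}" "2 * length ls + p \<le> K"
  shows "coeff_upto K p (prod_list (map2 M is ls)) = osc_coeff p is ls"
  using assms(2-)
proof (induction "is" ls arbitrary: p K rule: list_induct2)
  case (Cons i "is" l ls)
  then have "coeff_upto K p (prod_list (map2 M (i # is) (l # ls))) =
      of_nat (Suc p) * (A i l * coeff_upto (K - 1) (Suc p) (prod_list (map2 M is ls))) +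
      (\<Sum>r = 0..p. (\<Sum>j = 0..<m. X i j * W r j l) * coeff_upto (K - r) (p - r) (prod_list (map2 M is ls)))"
    by simp (subst coeff_upto_osc_matrix_mult [OF assms(1)], auto)
  also have "coeff_upto (K - 1) (Suc p) (prod_list (map2 M is ls)) = osc_coeff (Suc p) is ls"
    using Cons.prems by (intro Cons.IH) auto
  also have "(\<Sum>r = 0..p. (\<Sum>j = 0..<m. X i j * W r j l) * coeff_upto (K - r) (p - r) (prod_list (map2 M is ls))) =
      (\<Sum>r = 0..p. (\<Sum>j = 0..<m. X i j * W r j l) * osc_coeff (p - r) is ls)"
    using Cons.prems by (intro sum.cong refl arg_cong2 [where f = "(*)"] Cons.IH) auto
  finally show ?case by simp
qed (simp add: coeff_upto_one)

end

lemma vac_expect_eq_coeff_upto: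
  assumes "finite {w. scoeff f w \<noteq> 0 \<and> vac w \<noteq> 0}"
  obtains K where "N \<le> K" "vac_expect f = coeff_upto K 0 f"
proof
  let ?S = "{w. scoeff f w \<noteq> 0 \<and> vac w \<noteq> 0}"
  let ?K = "max N (Max (insert 0 (length ` ?S)))"
  show "vac_expect f = coeff_upto ?K 0 f"
    unfolding vac_expect_def coeff_upto_def vac_def [symmetric]
    using assms finite_osc_words [of ?K]
    by (intro sum.mono_neutral_left) (auto simp: le_max_iff_disj)
qed simp

section \<open>Column determinants\<close>

text \<open>Exactly \<open>j\<close> elements of \<open>L\<close> lie below entry \<open>j\<close>
  of the sorted list, and \<open>pick_card_in_set\<close> recovers an element from that
  number.\<close>

lemma pick_eq_sorted_list_of_set:
  assumes "finite L" "j < card L"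
  shows "pick L j = sorted_list_of_set L ! j"
proof -
  let ?l = "sorted_list_of_set L"
  have l: "set ?l = L" "length ?l = card L" "distinct ?l"
    using assms(1) by auto
  have less: "?l ! i < ?l ! k" if "i < k" "k < card L" for i k
    using that l(2) sorted_wrt_nth_less [OF strict_sorted_list_of_set [of L]] by simp
  have "{a \<in> L. a < ?l ! j} = (!) ?l ` {..<j}"
  proof safe
    fix a assume a: "a \<in> L" "a < ?l ! j"
    then obtain i where i: "i < card L" "a = ?l ! i"
      using l(1,2) by (metis in_set_conv_nth)
    have "i < j"
    proof (rule ccontr)
      assume "\<not> i < j"
      then have "?l ! j \<le> ?l ! i"
        using less [of j i] i(1) by (cases "i = j") auto
      then show False using a i by simp
    qed
    then show "a \<in> (!) ?l ` {..<j}" using i by blast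
  next
    fix i assume "i < j"
    then have "i < length ?l" using assms(2) l(2) by simp
    then show "?l ! i \<in> L" using nth_mem [of i ?l] l(1) by metis
    show "?l ! i < ?l ! j" by (rule less [OF \<open>i < j\<close> assms(2)])
  qed
  moreover have "inj_on ((!) ?l) {..<j}"
    using assms(2) l(2) inj_on_nth [OF l(3)] by simp
  ultimately have "card {a \<in> L. a < ?l ! j} = j"
    by (simp add: card_image)
  moreover have "?l ! j \<in> L"
    using assms(2) l nth_mem [of j ?l] by simp
  ultimately show ?thesis
    using pick_card_in_set [of "?l ! j" L] by simp
qed

lemma pick_atLeastLessThan: "i < n \<Longrightarrow> pick {0..<n} i = i"
proof -
  assume "i < n"
  moreover from this have "{a \<in> {0..<n}. a < i} = {0..<i}" by auto
  ultimately show ?thesis using pick_card_in_set [of i "{0..<n}"] by simp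
qed

lemma
  assumes "L \<subseteq> {0..<m}" "card L = n"
  shows submatrix_columns: "X \<in> carrier_mat n m \<Longrightarrow>
      submatrix X {0..<n} L = mat n n (\<lambda>(i,j). X $$ (i, sorted_list_of_set L ! j))"
    and submatrix_rows: "Y \<in> carrier_mat m n \<Longrightarrow>
      submatrix Y L {0..<n} = mat n n (\<lambda>(i,j). Y $$ (sorted_list_of_set L ! i, j))"
proof -
  have pick: "pick L j = sorted_list_of_set L ! j" if "j < n" for j
    using assms finite_subset [OF assms(1)] that by (simp add: pick_eq_sorted_list_of_set)
  have card: "card {i. i < m \<and> i \<in> L} = n" "card {i. i < n \<and> i \<in> {0..<n}} = n"
  proof -
    have "{i. i < m \<and> i \<in> L} = L" using assms(1) by auto
    then show "card {i. i < m \<and> i \<in> L} = n" using assms(2) by simp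
  qed simp
  show "submatrix X {0..<n} L = mat n n (\<lambda>(i,j). X $$ (i, sorted_list_of_set L ! j))"
    if "X \<in> carrier_mat n m"
    unfolding submatrix_def carrier_matD [OF that] card
    by (rule eq_matI) (simp_all add: pick pick_atLeastLessThan)
  show "submatrix Y L {0..<n} = mat n n (\<lambda>(i,j). Y $$ (sorted_list_of_set L ! i, j))"
    if "Y \<in> carrier_mat m n"
    unfolding submatrix_def carrier_matD [OF that] card
    by (rule eq_matI) (simp_all add: pick pick_atLeastLessThan)
qed

lemma sorted_list_of_set_nth_less:
  fixes m :: nat
  assumes "L \<subseteq> {0..<m}" "j < card L"
  shows "sorted_list_of_set L ! j < m"
proof -
  have "finite L" by (rule finite_subset [OF assms(1)]) simp
  then have "sorted_list_of_set L ! j \<in> L"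
    using assms(2) by (metis nth_mem set_sorted_list_of_set sorted_list_of_set.length_sorted_key_list_of_set)
  then show ?thesis using assms(1) by auto
qed

theorem cauchy_binet_col_det:
  fixes X Y A B :: "'a::ring_1 mat"
  assumes X: "X \<in> carrier_mat n m" and Y: "Y \<in> carrier_mat m n"
    and A: "A \<in> carrier_mat n n" and B: "B \<in> carrier_mat m m"
    and B_central: "\<And>i j r. i < m \<Longrightarrow> j < m \<Longrightarrow> commutator (B $$ (i,j)) r = 0"
    and XY: "\<And>i j k l. i < n \<Longrightarrow> j < m \<Longrightarrow> k < m \<Longrightarrow> l < n \<Longrightarrow>
      commutator (X $$ (i,j)) (Y $$ (k,l)) = - (A $$ (i,l) * B $$ (k,j))"
    and X_rpc: "row_pseudo_commutative X"
    and XA: "\<And>i j k l. i < n \<Longrightarrow> j < m \<Longrightarrow> k < n \<Longrightarrow> l < n \<Longrightarrow>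
      commutator (X $$ (i,j)) (A $$ (k,l)) - commutator (X $$ (k,j)) (A $$ (i,l)) = 0"
  shows "(\<Sum>L | L \<subseteq> {0..<m} \<and> card L = n.
      col_det (submatrix X {0..<n} L) * col_det (submatrix Y L {0..<n}))
    = vac_expect (col_det (osc_matrix Ann Cre A B X Y))"
proof -
  note dims = X [THEN carrier_matD(1)] X [THEN carrier_matD(2)] Y [THEN carrier_matD(1)]
    Y [THEN carrier_matD(2)] A [THEN carrier_matD(1)] A [THEN carrier_matD(2)]
    B [THEN carrier_matD(1)] B [THEN carrier_matD(2)]
  have XX: "commutator (X $$ (i,j)) (X $$ (k,l)) = commutator (X $$ (k,j)) (X $$ (i,l))"
    and Xcol: "commutator (X $$ (i,j)) (X $$ (k,j)) = 0" if "i < n" "k < n" "j < m" "l < m" for i j k l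
  proof -
    have "commutator (X\<^sup>T $$ (j,i)) (X\<^sup>T $$ (l,k)) = commutator (X\<^sup>T $$ (j,k)) (X\<^sup>T $$ (l,i))"
      and "commutator (X\<^sup>T $$ (j,i)) (X\<^sup>T $$ (j,k)) = 0"
      using X_rpc that unfolding row_pseudo_commutative_def column_pseudo_commutative_def
        index_transpose_mat dims by blast+
    then show "commutator (X $$ (i,j)) (X $$ (k,l)) = commutator (X $$ (k,j)) (X $$ (i,l))"
      and "commutator (X $$ (i,j)) (X $$ (k,j)) = 0"
      using that by (simp_all only: index_transpose_mat dims)
  qed
  interpret capelli n m "matrix_fun X" "matrix_fun Y" "matrix_fun A" "matrix_fun B"
  proof
    have X_fun: "matrix_fun X i j = (if i < n \<and> j < m then X $$ (i,j) else 0)"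
      and Y_fun: "matrix_fun Y j i = (if i < n \<and> j < m then Y $$ (j,i) else 0)" for i j
      by (auto simp: matrix_fun_def dims)
    have A_fun: "matrix_fun A i j = (if i < n \<and> j < n then A $$ (i,j) else 0)"
      and B_fun: "matrix_fun B k l = (if k < m \<and> l < m then B $$ (k,l) else 0)" for i j k l
      by (auto simp: matrix_fun_def dims)
    note [simp] = X_fun Y_fun A_fun B_fun
    show "matrix_fun B i j * r = r * matrix_fun B i j" for i j r
    proof (cases "i < m \<and> j < m")
      case True
      then show ?thesis using B_central [of i j r] unfolding commutator_def by simp
    qed auto
    show "matrix_fun X i j * matrix_fun Y k l - matrix_fun Y k l * matrix_fun X i j =
        - (matrix_fun A i l * matrix_fun B k j)" for i j k l
    proof (cases "i < n \<and> j < m \<and> k < m \<and> l < n")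
      case True
      then show ?thesis using XY [of i j k l] unfolding commutator_def by simp
    qed auto
    show "matrix_fun X i j * matrix_fun X k l - matrix_fun X k l * matrix_fun X i j =
        matrix_fun X k j * matrix_fun X i l - matrix_fun X i l * matrix_fun X k j" for i j k l
    proof (cases "i < n \<and> j < m \<and> k < n \<and> l < m")
      case True
      then show ?thesis using XX [of i k j l] unfolding commutator_def by simp
    qed auto
    show "matrix_fun X i j * matrix_fun X k j = matrix_fun X k j * matrix_fun X i j" for i j k
    proof (cases "i < n \<and> j < m \<and> k < n")
      case True
      then show ?thesis using Xcol [of i k j j] unfolding commutator_def by simp
    qed auto
    show "matrix_fun X i j * matrix_fun A k l - matrix_fun A k l * matrix_fun X i j =
        matrix_fun X k j * matrix_fun A i l - matrix_fun A i l * matrix_fun X k j" for i j k l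
    proof (cases "i < n \<and> j < m \<and> k < n \<and> l < n")
      case True
      then show ?thesis using XA [of i j k l] unfolding commutator_def by simp
    qed auto
  qed
  have Bpow: "Bpow r k j = (B ^\<^sub>m r) $$ (k,j)" if "k < m" "j < m" for r k j
    using that
  proof (induction r arbitrary: j)
    case (Suc r)
    have "B ^\<^sub>m r \<in> carrier_mat m m" using B by simp
    then have "(B ^\<^sub>m Suc r) $$ (k,j) = (\<Sum>i = 0..<m. (B ^\<^sub>m r) $$ (k,i) * B $$ (i,j))"
      using B Suc.prems by (simp add: scalar_prod_def)
    moreover have "matrix_fun B i j = B $$ (i,j)" if "i < m" for i
      using that Suc.prems by (simp add: matrix_fun_def dims)
    ultimately show ?case
      using Suc by (simp del: index_mult_mat)
  qed (simp add: dims)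
  have W: "W r k l = (\<Sum>j = 0..<m. (B ^\<^sub>m r) $$ (k,j) * Y $$ (j,l))" if "k < m" "l < n" for r k l
    using that by (auto simp: W_def Bpow matrix_fun_def dims)
  let ?M = "osc_matrix Ann Cre A B X Y"
  have M: "dim_col ?M = n"
    using A X Y by (simp add: osc_matrix_def)
  have entry: "scoeff (?M $$ (i,l)) u = (if u = [Ann] then matrix_fun A i l else 0) +
      (if u = replicate (length u) Cre then \<Sum>j = 0..<m. matrix_fun X i j * W (length u) j l else 0)"
    if "i < n" "l < n" for i l u
    using that by (simp add: scoeff_osc_matrix [OF X Y A B that] W matrix_fun_def dims)
  \<comment> \<open>The bound \<open>2 * n\<close> is what \<open>coeff_upto_prod_list\<close>
    requires for \<open>n\<close> factors and p = 0.\<close>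
  obtain K where K: "2 * n \<le> K" "vac_expect (col_det ?M) = coeff_upto K 0 (col_det ?M)"
    using vac_expect_eq_coeff_upto [OF finite_col_det [OF _ X Y A B]] by (metis osc.distinct(1))
  have perm_less: "\<sigma> j < n" if "\<sigma> permutes {0..<n}" "j < n" for \<sigma> j
    using permutes_in_image [OF that(1), of j] that(2) by simp
  have "coeff_upto K 0 (col_det ?M) =
      (\<Sum>\<sigma> | \<sigma> permutes {0..<n}. of_int (sign \<sigma>) * osc_coeff 0 (map \<sigma> [0..<n]) [0..<n])"
    unfolding col_det_def M coeff_upto_sum coeff_upto_sign
  proof (rule sum.cong)
    fix \<sigma> assume "\<sigma> \<in> {\<sigma>. \<sigma> permutes {0..<n}}"
    then have \<sigma>: "\<sigma> permutes {0..<n}" by simp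
    have "map (\<lambda>j. ?M $$ (\<sigma> j, j)) [0..<n] = map2 (\<lambda>i l. ?M $$ (i,l)) (map \<sigma> [0..<n]) [0..<n]"
      by (intro nth_equalityI) auto
    moreover have "coeff_upto K 0 (prod_list (map2 (\<lambda>i l. ?M $$ (i,l)) (map \<sigma> [0..<n]) [0..<n])) =
        osc_coeff 0 (map \<sigma> [0..<n]) [0..<n]"
      by (rule coeff_upto_prod_list [OF entry]) (use K(1) \<sigma> perm_less in auto)
    ultimately show "of_int (sign \<sigma>) * coeff_upto K 0 (prod_list (map (\<lambda>j. ?M $$ (\<sigma> j, j)) [0..<n])) =
        of_int (sign \<sigma>) * osc_coeff 0 (map \<sigma> [0..<n]) [0..<n]"
      by simp
  qed simp
  also have "\<dots> = (\<Sum>L | L \<subseteq> {0..<m} \<and> card L = n.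
      col_det (submatrix X {0..<n} L) * col_det (submatrix Y L {0..<n}))"
    unfolding cauchy_binet_core [symmetric]
  proof (intro sum.cong refl)
    fix L assume "L \<in> {L. L \<subseteq> {0..<m} \<and> card L = n}"
    then have L: "L \<subseteq> {0..<m}" "card L = n" by auto
    let ?l = "sorted_list_of_set L"
    have less: "?l ! j < m" if "j < n" for j
      using sorted_list_of_set_nth_less [OF L(1), of j] L(2) that by simp
    have "(\<Sum>\<sigma> | \<sigma> permutes {0..<n}. of_int (sign \<sigma>) *
          prod_list (map (\<lambda>j. matrix_fun X (\<sigma> j) (?l ! j)) [0..<n])) = col_det (submatrix X {0..<n} L)"
      unfolding submatrix_columns [OF L X] col_det_def
      by (intro sum.cong arg_cong2 [where f = "(*)"] arg_cong [where f = prod_list])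
        (auto simp: less perm_less matrix_fun_def dims)
    moreover have "(\<Sum>\<sigma> | \<sigma> permutes {0..<n}. of_int (sign \<sigma>) *
          prod_list (map (\<lambda>j. matrix_fun Y (?l ! \<sigma> j) j) [0..<n])) = col_det (submatrix Y L {0..<n})"
      unfolding submatrix_rows [OF L Y] col_det_def
      by (intro sum.cong arg_cong2 [where f = "(*)"] arg_cong [where f = prod_list])
        (auto simp: less perm_less matrix_fun_def dims)
    ultimately show "(\<Sum>\<sigma> | \<sigma> permutes {0..<n}. of_int (sign \<sigma>) *
          prod_list (map (\<lambda>j. matrix_fun X (\<sigma> j) (?l ! j)) [0..<n])) *
        (\<Sum>\<sigma> | \<sigma> permutes {0..<n}. of_int (sign \<sigma>) *
          prod_list (map (\<lambda>j. matrix_fun Y (?l ! \<sigma> j) j) [0..<n])) =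
        col_det (submatrix X {0..<n} L) * col_det (submatrix Y L {0..<n})"
      by simp
  qed
  finally show ?thesis using K(2) by simp
qed

section \<open>Adjoint words\<close>

fun adjoint :: "osc \<Rightarrow> osc" where
  "adjoint Ann = Cre"
| "adjoint Cre = Ann"

lemma adjoint_involution [simp]: "adjoint (adjoint c) = c"
  by (cases c) simp_all

text \<open>The inner product on \<open>\<int>[x]\<close> with \<open>\<langle>x\<^sup>i, x\<^sup>j\<rangle> = i! \<delta>\<^sub>i\<^sub>j\<close>, for which
  multiplication by $x$ and $d/dx$ are adjoint to each other.\<close>

definition fock_inner :: "int poly \<Rightarrow> int poly \<Rightarrow> int" where
  "fock_inner p q = (\<Sum>i\<le>degree p. fact i * coeff p i * coeff q i)"

lemma fock_inner_eq: "degree p \<le> N \<Longrightarrow> fock_inner p q = (\<Sum>i\<le>N. fact i * coeff p i * coeff q i)"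
  unfolding fock_inner_def by (intro sum.mono_neutral_left) (auto simp: coeff_eq_0)

lemma fock_inner_commute: "fock_inner p q = fock_inner q p"
  using fock_inner_eq [of p "max (degree p) (degree q)" q]
    fock_inner_eq [of q "max (degree p) (degree q)" p]
  by (simp add: mult.commute mult.left_commute)

text \<open>Multiplication by x shifts the index by one, and the quotient of the weights (i+1)! and
  i! is the factor i + 1 of the derivative.\<close>

lemma fock_inner_Cre: "fock_inner (osc_act Cre p) q = fock_inner p (osc_act Ann q)"
proof -
  have "degree (osc_act Cre p) \<le> Suc (degree p)"
    by (simp add: degree_pCons_le)
  from fock_inner_eq [OF this, of q]
  have "fock_inner (osc_act Cre p) q = (\<Sum>i\<le>degree p. fact (Suc i) * coeff p i * coeff q (Suc i))"
    by (simp add: sum.atMost_Suc_shift del: sum.atMost_Suc fact_Suc)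
  also have "\<dots> = fock_inner p (osc_act Ann q)"
    unfolding fock_inner_def by (intro sum.cong) (simp_all add: coeff_pderiv algebra_simps)
  finally show ?thesis .
qed

lemma fock_inner_adjoint: "fock_inner (osc_act (adjoint c) p) q = fock_inner p (osc_act c q)"
proof (cases c)
  case Ann
  then show ?thesis using fock_inner_Cre [of p q] by simp
next
  case Cre
  then show ?thesis
    using fock_inner_Cre [of q p] by (simp add: fock_inner_commute)
qed

lemma fock_inner_foldr_adjoint:
  "fock_inner (foldr osc_act (map adjoint (rev w)) p) q = fock_inner p (foldr osc_act w q)"
proof (induction w arbitrary: p)
  case (Cons c w)
  then show ?case by (simp add: fock_inner_adjoint del: osc_act.simps)
qed simp

text \<open>The expectation of a word is its matrix element between 1 and 1. Reversing the word and
  taking adjoints moves it to the other argument of the symmetric inner product.\<close>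

lemma vac_adjoint: "vac (map adjoint (rev w)) = vac w"
proof -
  have one: "fock_inner 1 p = coeff p 0" for p
    by (simp add: fock_inner_def)
  show ?thesis
    using fock_inner_foldr_adjoint [of w 1 1] one
      fock_inner_commute [of 1 "foldr osc_act (map adjoint (rev w)) 1"]
    by (simp add: vac_def)
qed

section \<open>The opposite ring\<close>

text \<open>A separate type lets the reversed product be an instance of \<open>ring_1\<close>, so
  that the column theorem can be applied to it.\<close>

typedef 'a opposite = "UNIV :: 'a set" morphisms unop Op ..

setup_lifting type_definition_opposite

instantiation opposite :: (ring_1) ring_1
begin

lift_definition zero_opposite :: "'a opposite" is 0 .
lift_definition one_opposite :: "'a opposite" is 1 .
lift_definition plus_opposite :: "'a opposite \<Rightarrow> 'a opposite \<Rightarrow> 'a opposite" is "(+)" .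
lift_definition minus_opposite :: "'a opposite \<Rightarrow> 'a opposite \<Rightarrow> 'a opposite" is "(-)" .
lift_definition uminus_opposite :: "'a opposite \<Rightarrow> 'a opposite" is uminus .
lift_definition times_opposite :: "'a opposite \<Rightarrow> 'a opposite \<Rightarrow> 'a opposite" is "\<lambda>x y. y * x" .

instance by standard (transfer; simp add: algebra_simps)+

end

section \<open>Antihomomorphisms and reflection in the antidiagonal\<close>

locale ring_antihom =
  fixes \<phi> :: "'a::ring_1 \<Rightarrow> 'b::ring_1"
  assumes add: "\<phi> (x + y) = \<phi> x + \<phi> y" and mult: "\<phi> (x * y) = \<phi> y * \<phi> x"
    and one [simp]: "\<phi> 1 = 1"
begin

lemma zero [simp]: "\<phi> 0 = 0"
  using add [of 0 0] by simp

lemma minus: "\<phi> (- x) = - \<phi> x"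
  using add [of x "- x"] by (simp add: eq_neg_iff_add_eq_0 add.commute)

lemma diff: "\<phi> (x - y) = \<phi> x - \<phi> y"
  using add [of x "- y"] by (simp add: minus)

lemma sum: "\<phi> (sum f S) = (\<Sum>x\<in>S. \<phi> (f x))"
  by (induction S rule: infinite_finite_induct) (simp_all add: add)

lemma commutator: "commutator (\<phi> x) (\<phi> y) = - \<phi> (commutator x y)"
  by (simp add: commutator_def diff mult)

lemma sign_mult: "\<phi> (of_int (sign \<sigma>) * x) = of_int (sign \<sigma>) * \<phi> x"
  by (cases \<sigma> rule: sign_cases) (simp_all add: minus)

lemma prod_list: "\<phi> (prod_list xs) = prod_list (rev (map \<phi> xs))"
  by (induction xs) (simp_all add: mult)

text \<open>An antihomomorphism reverses ordered products. After a plain transposition the columns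
  would be multiplied in decreasing order; reflection in the antidiagonal also reverses the indices
  and so restores the increasing order.\<close>

definition antitranspose :: "'a mat \<Rightarrow> 'b mat" where
  "antitranspose M = mat (dim_col M) (dim_row M)
     (\<lambda>(i,j). \<phi> (M $$ (dim_row M - 1 - j, dim_col M - 1 - i)))"

lemma antitranspose_carrier [simp]:
  "M \<in> carrier_mat n m \<Longrightarrow> antitranspose M \<in> carrier_mat m n"
  by (simp add: antitranspose_def)

lemma antitranspose_index:
  "M \<in> carrier_mat n m \<Longrightarrow> i < m \<Longrightarrow> j < n \<Longrightarrow>
    antitranspose M $$ (i,j) = \<phi> (M $$ (n - 1 - j, m - 1 - i))"
  by (auto simp: antitranspose_def)

end

definition reverse_index :: "nat \<Rightarrow> nat \<Rightarrow> nat" where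
  "reverse_index n i = (if i < n then n - 1 - i else i)"

lemma reverse_index_involution [simp]: "reverse_index n (reverse_index n i) = i"
  by (auto simp: reverse_index_def)

lemma reverse_index_less [simp]: "reverse_index n i < n \<longleftrightarrow> i < n"
  by (auto simp: reverse_index_def)

lemma reverse_index_permutes: "reverse_index n permutes {0..<n}"
proof (rule bij_imp_permutes)
  show "bij_betw (reverse_index n) {0..<n} {0..<n}"
    by (rule bij_betwI [where g = "reverse_index n"]) auto
qed (auto simp: reverse_index_def)

lemma sum_reverse_index:
  fixes n :: nat
  shows "(\<Sum>i = 0..<n. f (n - 1 - i)) = (\<Sum>i = 0..<n. f i)"
  by (rule sum.reindex_bij_witness [of _ "\<lambda>i. n - 1 - i" "\<lambda>i. n - 1 - i"]) auto

lemma rev_map_upt: "rev (map f [0..<n]) = map (\<lambda>i. f (n - 1 - i)) [0..<n]"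
  by (rule nth_equalityI) (auto simp: rev_nth)

text \<open>Row n - 1 - j of \<open>M\<close> becomes column j, so the reversed product again visits
  the columns in order. The permutation is replaced by its conjugate under the reversal of indices,
  which has the same sign.\<close>

lemma (in ring_antihom) col_det_antitranspose:
  assumes M: "M \<in> carrier_mat n n"
  shows "col_det (antitranspose M) = \<phi> (row_det M)"
proof -
  let ?r = "reverse_index n"
  have dim: "dim_col (antitranspose M) = n" "dim_row M = n"
    using M by (simp_all add: antitranspose_def)
  have "\<phi> (row_det M) = (\<Sum>\<sigma> | \<sigma> permutes {0..<n}. of_int (sign \<sigma>) *
      prod_list (map (\<lambda>j. \<phi> (M $$ (n - 1 - j, \<sigma> (n - 1 - j)))) [0..<n]))"
    by (simp add: row_det_def dim sum sign_mult prod_list rev_map_upt o_def)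
  also have "\<dots> = (\<Sum>\<sigma> | \<sigma> permutes {0..<n}. of_int (sign \<sigma>) *
      prod_list (map (\<lambda>j. antitranspose M $$ (\<sigma> j, j)) [0..<n]))"
  proof (rule sum.reindex_bij_witness [of _ "\<lambda>\<sigma>. ?r \<circ> \<sigma> \<circ> ?r" "\<lambda>\<sigma>. ?r \<circ> \<sigma> \<circ> ?r"])
    fix \<sigma> assume "\<sigma> \<in> {\<sigma>. \<sigma> permutes {0..<n}}"
    then have \<sigma>: "\<sigma> permutes {0..<n}" by simp
    show "?r \<circ> (?r \<circ> \<sigma> \<circ> ?r) \<circ> ?r = \<sigma>" by (simp add: fun_eq_iff)
    show "?r \<circ> \<sigma> \<circ> ?r \<in> {\<sigma>. \<sigma> permutes {0..<n}}"
      using \<sigma> reverse_index_permutes by (auto intro: permutes_compose)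
    have perm: "permutation \<sigma>" "permutation ?r"
      using \<sigma> reverse_index_permutes permutes_imp_permutation [of "{0..<n}"] by auto
    then have "sign (?r \<circ> \<sigma> \<circ> ?r) = sign \<sigma>"
      by (simp add: sign_compose permutation_compose)
    moreover have "antitranspose M $$ ((?r \<circ> \<sigma> \<circ> ?r) j, j) = \<phi> (M $$ (n - 1 - j, \<sigma> (n - 1 - j)))"
      if "j < n" for j
    proof -
      have "\<sigma> (n - 1 - j) < n"
        using permutes_in_image [OF \<sigma>, of "n - 1 - j"] that by simp
      then show ?thesis
        using that by (simp add: antitranspose_index [OF M] reverse_index_def)
    qed
    ultimately show "of_int (sign (?r \<circ> \<sigma> \<circ> ?r)) *
        prod_list (map (\<lambda>j. antitranspose M $$ ((?r \<circ> \<sigma> \<circ> ?r) j, j)) [0..<n]) =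
        of_int (sign \<sigma>) * prod_list (map (\<lambda>j. \<phi> (M $$ (n - 1 - j, \<sigma> (n - 1 - j)))) [0..<n])"
      by (intro arg_cong2 [where f = "(*)"] arg_cong [where f = prod_list]) auto
  qed (use reverse_index_permutes in \<open>auto simp: fun_eq_iff intro: permutes_compose\<close>)
  finally show ?thesis by (simp add: col_det_def dim)
qed

lemma sorted_list_of_set_reverse_index:
  assumes "L \<subseteq> {0..<m}"
  shows "sorted_list_of_set (reverse_index m ` L) = rev (map (reverse_index m) (sorted_list_of_set L))"
proof -
  let ?l = "sorted_list_of_set L"
  have fin: "finite L" using assms finite_subset by blast
  have "sorted_wrt (\<lambda>x y. reverse_index m y < reverse_index m x) ?l"
  proof (rule sorted_wrt_mono_rel [OF _ strict_sorted_list_of_set])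
    fix x y assume "x \<in> set ?l" "y \<in> set ?l" "x < y"
    then show "reverse_index m y < reverse_index m x"
      using assms fin by (auto simp: reverse_index_def)
  qed
  then have "sorted_wrt (<) (rev (map (reverse_index m) ?l))"
    by (simp add: sorted_wrt_rev sorted_wrt_map)
  then show ?thesis
    by (rule strict_sorted_equal [OF strict_sorted_list_of_set, symmetric]) (use fin in simp)
qed

lemma (in ring_antihom) submatrix_antitranspose:
  assumes M: "M \<in> carrier_mat m n" and L: "L \<subseteq> {0..<m}" "card L = n"
  shows "submatrix (antitranspose M) {0..<n} (reverse_index m ` L) = antitranspose (submatrix M L {0..<n})"
    and "N \<in> carrier_mat n m \<Longrightarrow>
      submatrix (antitranspose N) (reverse_index m ` L) {0..<n} = antitranspose (submatrix N {0..<n} L)"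
proof -
  let ?r = "reverse_index m"
  have fin: "finite L" using L(1) finite_subset by blast
  have rL: "?r ` L \<subseteq> {0..<m}" using L(1) by auto
  have "inj_on ?r L"
    by (metis inj_onI reverse_index_involution)
  then have card: "card (?r ` L) = n"
    using L(2) by (simp add: card_image)
  have nth: "sorted_list_of_set (?r ` L) ! j = m - 1 - sorted_list_of_set L ! (n - 1 - j)"
    and less: "m - 1 - sorted_list_of_set L ! (n - 1 - j) < m"
    and less': "sorted_list_of_set L ! (n - 1 - j) < m" if "j < n" for j
  proof -
    show *: "sorted_list_of_set L ! (n - 1 - j) < m"
      using sorted_list_of_set_nth_less [OF L(1), of "n - 1 - j"] L(2) that by simp
    then show "sorted_list_of_set (?r ` L) ! j = m - 1 - sorted_list_of_set L ! (n - 1 - j)"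
      and "m - 1 - sorted_list_of_set L ! (n - 1 - j) < m"
      unfolding sorted_list_of_set_reverse_index [OF L(1)]
      using L(2) that fin by (simp_all add: rev_nth reverse_index_def)
  qed
  have dbl: "m - 1 - (m - 1 - x) = x" if "x < m" for x using that by simp
  show "submatrix (antitranspose M) {0..<n} (?r ` L) = antitranspose (submatrix M L {0..<n})"
    unfolding submatrix_columns [OF rL card antitranspose_carrier [OF M]] submatrix_rows [OF L M]
  proof (rule eq_matI)
    let ?S = "mat n n (\<lambda>(i,j). M $$ (sorted_list_of_set L ! i, j))"
    fix i j assume "i < dim_row (antitranspose ?S)" "j < dim_col (antitranspose ?S)"
    then have ij: "i < n" "j < n" by (simp_all add: antitranspose_def)
    then have "antitranspose ?S $$ (i,j) = \<phi> (M $$ (sorted_list_of_set L ! (n - 1 - j), n - 1 - i))"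
      by (simp add: antitranspose_def)
    moreover have "antitranspose M $$ (i, sorted_list_of_set (?r ` L) ! j) =
        \<phi> (M $$ (sorted_list_of_set L ! (n - 1 - j), n - 1 - i))"
      unfolding nth [OF ij(2)] antitranspose_index [OF M ij(1) less [OF ij(2)]] dbl [OF less' [OF ij(2)]] ..
    ultimately show "mat n n (\<lambda>(i,j). antitranspose M $$ (i, sorted_list_of_set (?r ` L) ! j)) $$ (i,j) =
        antitranspose ?S $$ (i,j)"
      using ij by simp
  qed (simp_all add: antitranspose_def)
  show "submatrix (antitranspose N) (?r ` L) {0..<n} = antitranspose (submatrix N {0..<n} L)"
    if N: "N \<in> carrier_mat n m"
    unfolding submatrix_rows [OF rL card antitranspose_carrier [OF N]] submatrix_columns [OF L N]
  proof (rule eq_matI)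
    let ?S = "mat n n (\<lambda>(i,j). N $$ (i, sorted_list_of_set L ! j))"
    fix i j assume "i < dim_row (antitranspose ?S)" "j < dim_col (antitranspose ?S)"
    then have ij: "i < n" "j < n" by (simp_all add: antitranspose_def)
    then have "antitranspose ?S $$ (i,j) = \<phi> (N $$ (n - 1 - j, sorted_list_of_set L ! (n - 1 - i)))"
      by (simp add: antitranspose_def)
    moreover have "antitranspose N $$ (sorted_list_of_set (?r ` L) ! i, j) =
        \<phi> (N $$ (n - 1 - j, sorted_list_of_set L ! (n - 1 - i)))"
      unfolding nth [OF ij(1)] antitranspose_index [OF N less [OF ij(1)] ij(2)] dbl [OF less' [OF ij(1)]] ..
    ultimately show "mat n n (\<lambda>(i,j). antitranspose N $$ (sorted_list_of_set (?r ` L) ! i, j)) $$ (i,j) =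
        antitranspose ?S $$ (i,j)"
      using ij by simp
  qed (simp_all add: antitranspose_def)
qed

lemma (in ring_antihom) antitranspose_mult:
  assumes M: "M \<in> carrier_mat n k" and N: "N \<in> carrier_mat k m"
  shows "antitranspose (M * N) = antitranspose N * antitranspose M"
proof (rule eq_matI)
  have MN: "M * N \<in> carrier_mat n m" using M N by simp
  fix i j assume "i < dim_row (antitranspose N * antitranspose M)"
    "j < dim_col (antitranspose N * antitranspose M)"
  then have ij: "i < m" "j < n" using M N by (auto simp: antitranspose_def)
  have "antitranspose (M * N) $$ (i,j) =
      (\<Sum>h = 0..<k. \<phi> (N $$ (h, m - 1 - i)) * \<phi> (M $$ (n - 1 - j, h)))"
    using M N ij by (simp add: antitranspose_index [OF MN] scalar_prod_def sum mult)
  also have "\<dots> = (\<Sum>h = 0..<k. \<phi> (N $$ (k - 1 - h, m - 1 - i)) * \<phi> (M $$ (n - 1 - j, k - 1 - h)))"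
    by (rule sum_reverse_index [symmetric])
  also have "\<dots> = (antitranspose N * antitranspose M) $$ (i,j)"
    using M N ij antitranspose_carrier [OF M] antitranspose_carrier [OF N]
    by (simp add: scalar_prod_def antitranspose_index [OF M] antitranspose_index [OF N]
        carrier_matD [OF antitranspose_carrier [OF M]] carrier_matD [OF antitranspose_carrier [OF N]])
  finally show "antitranspose (M * N) $$ (i,j) = (antitranspose N * antitranspose M) $$ (i,j)" .
qed (use M N in \<open>auto simp: antitranspose_def\<close>)

lemma (in ring_antihom) antitranspose_pow:
  assumes M: "M \<in> carrier_mat n n"
  shows "antitranspose (M ^\<^sub>m r) = antitranspose M ^\<^sub>m r"
proof (induction r)
  case 0
  show ?case using M by (intro eq_matI) (auto simp: antitranspose_def)
next
  case (Suc r)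
  \<comment> \<open>The reflection turns \<open>M ^\<^sub>m r * M\<close> into a product with the
    single factor on the left, while the power of a matrix is built with it on the right.\<close>
  have comm: "N ^\<^sub>m r * N = N * N ^\<^sub>m r" if "N \<in> carrier_mat n n" for N :: "'b mat"
  proof (induction r)
    case (Suc r)
    have "N ^\<^sub>m r \<in> carrier_mat n n" using that by simp
    then show ?case using that by (simp add: Suc assoc_mult_mat [of _ n n _ n _ n])
  qed (use that in simp)
  have "M ^\<^sub>m r \<in> carrier_mat n n" using M by simp
  then show ?case
    using M by (simp add: antitranspose_mult [of _ n n] Suc comm)
qed

interpretation Op: ring_antihom Op
  by unfold_locales (simp_all add: plus_opposite.abs_eq times_opposite.abs_eq one_opposite.abs_eq)

section \<open>Row determinants\<close>

text \<open>Reversing the words and passing to the opposite ring gives an antihomomorphism of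
  series. Exchanging the two letters as well makes it compatible with the vacuum expectation, by
  \<open>vac_adjoint\<close>.\<close>

definition osc_adjoint :: "'a::ring_1 osc_series \<Rightarrow> 'a opposite osc_series" where
  "osc_adjoint f = Series (\<lambda>w. Op (scoeff f (map adjoint (rev w))))"

lemma scoeff_osc_adjoint: "scoeff (osc_adjoint f) w = Op (scoeff f (map adjoint (rev w)))"
  by (simp add: osc_adjoint_def)

interpretation osc_adjoint: ring_antihom osc_adjoint
proof
  fix f g :: "'a osc_series"
  show "osc_adjoint (f + g) = osc_adjoint f + osc_adjoint g"
    by (rule osc_series_eqI) (simp add: scoeff_osc_adjoint Op.add)
  show "osc_adjoint 1 = (1 :: 'a opposite osc_series)"
    by (rule osc_series_eqI) (simp add: scoeff_osc_adjoint)
  show "osc_adjoint (f * g) = osc_adjoint g * osc_adjoint f"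
  proof (rule osc_series_eqI)
    fix w
    let ?a = "\<lambda>w. map adjoint (rev w)"
    have "scoeff (osc_adjoint (f * g)) w =
        (\<Sum>k = 0..length w. Op (scoeff g (drop k (?a w))) * Op (scoeff f (take k (?a w))))"
      by (simp add: scoeff_osc_adjoint scoeff_mult Op.sum Op.mult)
    also have "\<dots> = (\<Sum>k = 0..length w. Op (scoeff g (?a (take k w))) * Op (scoeff f (?a (drop k w))))"
      by (rule sum.reindex_bij_witness [of _ "\<lambda>k. length w - k" "\<lambda>k. length w - k"])
        (auto simp: take_map drop_map take_rev drop_rev)
    also have "\<dots> = scoeff (osc_adjoint g * osc_adjoint f) w"
      by (simp add: scoeff_osc_adjoint scoeff_mult)
    finally show "scoeff (osc_adjoint (f * g)) w = scoeff (osc_adjoint g * osc_adjoint f) w" .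
  qed
qed

lemma map_adjoint_rev_involution [simp]: "map adjoint (rev (map adjoint (rev w))) = w"
  by (simp add: rev_map o_def)

lemma map_adjoint_rev_eq_iff: "map adjoint (rev u) = v \<longleftrightarrow> u = map adjoint (rev v)"
  by (metis map_adjoint_rev_involution)

lemma Op_of_int: "Op (of_int k) = of_int k"
proof -
  have "Op (of_nat j) = of_nat j" for j
    by (induction j) (simp_all add: Op.add)
  then show ?thesis
    by (cases k rule: int_cases2) (simp_all add: Op.minus)
qed

lemma Op_eq_0_iff [simp]: "Op x = 0 \<longleftrightarrow> x = 0"
  by (metis Op.zero Op_inject UNIV_I)

lemma vac_expect_osc_adjoint: "vac_expect (osc_adjoint f) = Op (vac_expect f)"
proof -
  have "vac_expect (osc_adjoint f) =
      (\<Sum>w | scoeff f (map adjoint (rev w)) \<noteq> 0 \<and> vac w \<noteq> 0.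
        Op (scoeff f (map adjoint (rev w))) * of_int (vac w))"
    by (simp add: vac_expect_def scoeff_osc_adjoint)
  also have "\<dots> = (\<Sum>w | scoeff f w \<noteq> 0 \<and> vac w \<noteq> 0. Op (scoeff f w) * of_int (vac w))"
    by (rule sum.reindex_bij_witness [of _ "\<lambda>w. map adjoint (rev w)" "\<lambda>w. map adjoint (rev w)"])
      (simp_all only: vac_adjoint map_adjoint_rev_involution mem_Collect_eq simp_thms)
  also have "\<dots> = Op (vac_expect f)"
  proof -
    have "Op x * of_int k = Op (x * of_int k)" for x :: 'a and k
      by (metis Op.mult Op_of_int mult_of_int_commute)
    then show ?thesis by (simp add: vac_expect_def Op.sum)
  qed
  finally show ?thesis .
qed

lemma osc_matrix_carrier:
  assumes "X \<in> carrier_mat n m" "Y \<in> carrier_mat m n"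
  shows "osc_matrix c d A B X Y \<in> carrier_mat n n"
  using assms by (intro carrier_matI) (simp_all add: osc_matrix_def)

text \<open>Reversal of the triple product puts the reflected Y in the place of X and the reflected
  X in the place of Y. The exchange of letters turns the matrix of part (b) into one of the form in
  part (a).\<close>

lemma antitranspose_osc_matrix:
  assumes X: "X \<in> carrier_mat n m" and Y: "Y \<in> carrier_mat m n"
    and A: "A \<in> carrier_mat n n" and B: "B \<in> carrier_mat m m"
  shows "osc_adjoint.antitranspose (osc_matrix (adjoint c) (adjoint d) A B X Y) =
    osc_matrix c d (Op.antitranspose A) (Op.antitranspose B) (Op.antitranspose Y) (Op.antitranspose X)"
    (is "osc_adjoint.antitranspose ?M = ?N")
proof (rule eq_matI)
  have M: "?M \<in> carrier_mat n n"
    by (rule osc_matrix_carrier [OF X Y])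
  note N = Op.antitranspose_carrier [OF Y] Op.antitranspose_carrier [OF X]
    Op.antitranspose_carrier [OF A] Op.antitranspose_carrier [OF B]
  have dims: "dim_row ?N = n" "dim_col ?N = n"
    by (rule carrier_matD [OF osc_matrix_carrier [OF N(1,2)]])+
  then show "dim_row (osc_adjoint.antitranspose ?M) = dim_row ?N"
    "dim_col (osc_adjoint.antitranspose ?M) = dim_col ?N"
    using carrier_matD [OF osc_adjoint.antitranspose_carrier [OF M]] by auto
  fix i l assume "i < dim_row ?N" "l < dim_col ?N"
  then have il: "i < n" "l < n" by (simp_all add: dims)
  then have il': "n - 1 - l < n" "n - 1 - i < n" by auto
  show "osc_adjoint.antitranspose ?M $$ (i,l) = ?N $$ (i,l)"
  proof (rule osc_series_eqI)
    fix u :: "osc list"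
    let ?r = "length u"
    let ?x = "\<lambda>j. Op (X $$ (n - 1 - l, j))" and ?y = "\<lambda>k. Op (Y $$ (k, n - 1 - i))"
      and ?b = "\<lambda>j k. Op ((B ^\<^sub>m ?r) $$ (j,k))"
    have Br: "B ^\<^sub>m ?r \<in> carrier_mat m m" using B by simp
    have "scoeff (osc_adjoint.antitranspose ?M $$ (i,l)) u =
        (if u = [c] then Op (A $$ (n - 1 - l, n - 1 - i)) else 0) +
        (if u = replicate ?r d then
          Op (\<Sum>j = 0..<m. X $$ (n - 1 - l, j) * (\<Sum>k = 0..<m. (B ^\<^sub>m ?r) $$ (j,k) * Y $$ (k, n - 1 - i)))
          else 0)"
      unfolding osc_adjoint.antitranspose_index [OF M il] scoeff_osc_adjoint
        scoeff_osc_matrix [OF X Y A B il'] Op.add map_adjoint_rev_eq_iff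
      by (simp add: rev_replicate)
    also have "Op (\<Sum>j = 0..<m. X $$ (n - 1 - l, j) * (\<Sum>k = 0..<m. (B ^\<^sub>m ?r) $$ (j,k) * Y $$ (k, n - 1 - i))) =
        (\<Sum>j = 0..<m. \<Sum>k = 0..<m. ?y k * (?b j k * ?x j))"
      by (simp add: Op.sum Op.mult sum_distrib_right mult.assoc)
    also have "\<dots> = (\<Sum>k = 0..<m. ?y k * (\<Sum>j = 0..<m. ?b j k * ?x j))"
      by (subst sum.swap) (simp add: sum_distrib_left)
    \<comment> \<open>Reflected matrices are indexed from the far end, so both inner summation
      indices are reversed to match their entries.\<close>
    also have "\<dots> = (\<Sum>k = 0..<m. ?y (m - 1 - k) * (\<Sum>j = 0..<m. ?b j (m - 1 - k) * ?x j))"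
      by (rule sum_reverse_index [symmetric])
    also have "\<dots> = (\<Sum>k = 0..<m. ?y (m - 1 - k) * (\<Sum>j = 0..<m. ?b (m - 1 - j) (m - 1 - k) * ?x (m - 1 - j)))"
    proof (rule sum.cong [OF refl])
      fix k
      have "(\<Sum>j = 0..<m. ?b j (m - 1 - k) * ?x j) =
          (\<Sum>j = 0..<m. ?b (m - 1 - j) (m - 1 - k) * ?x (m - 1 - j))"
        by (rule sum_reverse_index [symmetric])
      then show "?y (m - 1 - k) * (\<Sum>j = 0..<m. ?b j (m - 1 - k) * ?x j) =
          ?y (m - 1 - k) * (\<Sum>j = 0..<m. ?b (m - 1 - j) (m - 1 - k) * ?x (m - 1 - j))"
        by (simp only:)
    qed
    also have "\<dots> = (\<Sum>j = 0..<m. Op.antitranspose Y $$ (i,j) *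
        (\<Sum>k = 0..<m. (Op.antitranspose B ^\<^sub>m ?r) $$ (j,k) * Op.antitranspose X $$ (k,l)))"
      unfolding Op.antitranspose_pow [OF B, symmetric]
      using il by (simp add: Op.antitranspose_index [OF Y] Op.antitranspose_index [OF X]
          Op.antitranspose_index [OF Br] del: pow_mat.simps)
    finally show "scoeff (osc_adjoint.antitranspose ?M $$ (i,l)) u = scoeff (?N $$ (i,l)) u"
      unfolding scoeff_osc_matrix [OF N il] using il by (simp add: Op.antitranspose_index [OF A])
  qed
qed

theorem cauchy_binet_row_det:
  fixes X Y A B :: "'a::ring_1 mat"
  assumes X: "X \<in> carrier_mat n m" and Y: "Y \<in> carrier_mat m n"
    and A: "A \<in> carrier_mat n n" and B: "B \<in> carrier_mat m m"
    and B_central: "\<And>i j r. i < m \<Longrightarrow> j < m \<Longrightarrow> commutator (B $$ (i,j)) r = 0"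
    and XY: "\<And>i j k l. i < n \<Longrightarrow> j < m \<Longrightarrow> k < m \<Longrightarrow> l < n \<Longrightarrow>
      commutator (X $$ (i,j)) (Y $$ (k,l)) = - (A $$ (i,l) * B $$ (k,j))"
    and Y_cpc: "column_pseudo_commutative Y"
    and YA: "\<And>i j k l. i < m \<Longrightarrow> j < n \<Longrightarrow> k < n \<Longrightarrow> l < n \<Longrightarrow>
      commutator (Y $$ (i,j)) (A $$ (k,l)) - commutator (Y $$ (i,l)) (A $$ (k,j)) = 0"
  shows "(\<Sum>L | L \<subseteq> {0..<m} \<and> card L = n.
      row_det (submatrix X {0..<n} L) * row_det (submatrix Y L {0..<n}))
    = vac_expect (row_det (osc_matrix Cre Ann A B X Y))"
proof -
  let ?X = "Op.antitranspose Y" and ?Y = "Op.antitranspose X"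
    and ?A = "Op.antitranspose A" and ?B = "Op.antitranspose B"
  note carriers = Op.antitranspose_carrier [OF Y] Op.antitranspose_carrier [OF X]
    Op.antitranspose_carrier [OF A] Op.antitranspose_carrier [OF B]
  note index = Op.antitranspose_index [OF Y] Op.antitranspose_index [OF X]
    Op.antitranspose_index [OF A] Op.antitranspose_index [OF B]
  have YY: "commutator (Y $$ (i,j)) (Y $$ (k,l)) = commutator (Y $$ (i,l)) (Y $$ (k,j))"
    and Yrow: "commutator (Y $$ (i,j)) (Y $$ (i,l)) = 0" if "i < m" "k < m" "j < n" "l < n" for i j k l
    using Y_cpc that unfolding column_pseudo_commutative_def carrier_matD [OF Y] by blast+
  have "(\<Sum>L | L \<subseteq> {0..<m} \<and> card L = n.
      col_det (submatrix ?X {0..<n} L) * col_det (submatrix ?Y L {0..<n}))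
    = vac_expect (col_det (osc_matrix Ann Cre ?A ?B ?X ?Y))"
  proof (rule cauchy_binet_col_det [OF carriers])
    fix i j and r :: "'a opposite" assume "i < m" "j < m"
    moreover obtain s where "r = Op s" by (cases r) auto
    ultimately show "commutator (?B $$ (i,j)) r = 0"
      by (simp add: index Op.commutator B_central)
  next
    fix i j k l assume ijkl: "i < n" "j < m" "k < m" "l < n"
    then have r: "n - 1 - i < n" "m - 1 - j < m" "m - 1 - k < m" "n - 1 - l < n" by auto
    let ?x = "X $$ (n - 1 - l, m - 1 - k)" and ?y = "Y $$ (m - 1 - j, n - 1 - i)"
      and ?a = "A $$ (n - 1 - l, n - 1 - i)" and ?b = "B $$ (m - 1 - j, m - 1 - k)"
    have "commutator (Op ?y) (Op ?x) = Op (commutator ?x ?y)"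
      by (simp add: commutator_def Op.diff Op.mult)
    \<comment> \<open>\<open>Op\<close> will also reverse the product of the entries of A and B;
      centrality of B exchanges them beforehand.\<close>
    also have "\<dots> = - Op (?b * ?a)"
      using B_central [OF r(2) r(3), of ?a]
      unfolding XY [OF r(4) r(3) r(2) r(1)] Op.minus by (simp add: commutator_def)
    finally show "commutator (?X $$ (i,j)) (?Y $$ (k,l)) = - (?A $$ (i,l) * ?B $$ (k,j))"
      using ijkl by (simp only: index Op.mult)
  next
    have "commutator (?X $$ (j,i)) (?X $$ (l,k)) = commutator (?X $$ (l,i)) (?X $$ (j,k))"
      and "commutator (?X $$ (j,i)) (?X $$ (l,i)) = 0"
      if "i < m" "j < n" "k < m" "l < n" for i j k l
    proof -
      have r: "m - 1 - i < m" "n - 1 - j < n" "m - 1 - k < m" "n - 1 - l < n" using that by auto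
      show "commutator (?X $$ (j,i)) (?X $$ (l,k)) = commutator (?X $$ (l,i)) (?X $$ (j,k))"
        using that YY [OF r(1) r(3) r(2) r(4)] by (simp add: index Op.commutator)
      show "commutator (?X $$ (j,i)) (?X $$ (l,i)) = 0"
        using that Yrow [OF r(1) r(1) r(2) r(4)] by (simp add: index Op.commutator)
    qed
    then show "row_pseudo_commutative ?X"
      unfolding row_pseudo_commutative_def column_pseudo_commutative_def
      by (auto simp: carrier_matD [OF carriers(1)])
  next
    fix i j k l assume ijkl: "i < n" "j < m" "k < n" "l < n"
    then have r: "n - 1 - i < n" "m - 1 - j < m" "n - 1 - k < n" "n - 1 - l < n" by auto
    show "commutator (?X $$ (i,j)) (?A $$ (k,l)) - commutator (?X $$ (k,j)) (?A $$ (i,l)) = 0"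
      using YA [OF r(2) r(1) r(4) r(3)] ijkl by (simp add: index Op.commutator)
  qed
  also have "osc_matrix Ann Cre ?A ?B ?X ?Y = osc_adjoint.antitranspose (osc_matrix Cre Ann A B X Y)"
    using antitranspose_osc_matrix [OF X Y A B, of Ann Cre] by simp
  also have "vac_expect (col_det \<dots>) = Op (vac_expect (row_det (osc_matrix Cre Ann A B X Y)))"
    by (simp only: osc_adjoint.col_det_antitranspose [OF osc_matrix_carrier [OF X Y]] vac_expect_osc_adjoint)
  also have "(\<Sum>L | L \<subseteq> {0..<m} \<and> card L = n.
      col_det (submatrix ?X {0..<n} L) * col_det (submatrix ?Y L {0..<n})) =
    (\<Sum>L | L \<subseteq> {0..<m} \<and> card L = n.
      Op (row_det (submatrix X {0..<n} L) * row_det (submatrix Y L {0..<n})))"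
  \<comment> \<open>Reflecting X and Y reflects the chosen rows and columns as well, so the summand
    for \<open>L\<close> belongs to the mirror image of \<open>L\<close>, which is again a subset of
    size \<open>n\<close>.\<close>
  proof (rule sum.reindex_bij_witness [of _ "(`) (reverse_index m)" "(`) (reverse_index m)"])
    fix L assume "L \<in> {L. L \<subseteq> {0..<m} \<and> card L = n}"
    then have L: "L \<subseteq> {0..<m}" "card L = n" by auto
    show "reverse_index m ` reverse_index m ` L = L"
      by (simp add: image_image)
    show rr: "reverse_index m ` reverse_index m ` L = L"
      by (simp add: image_image)
    have inj: "inj_on (reverse_index m) L"
      by (metis inj_onI reverse_index_involution)
    show "reverse_index m ` L \<in> {L. L \<subseteq> {0..<m} \<and> card L = n}"
      using L by (auto simp: card_image [OF inj])
    show rL: "reverse_index m ` L \<in> {L. L \<subseteq> {0..<m} \<and> card L = n}"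
      using L by (auto simp: card_image [OF inj])
    then have L': "reverse_index m ` L \<subseteq> {0..<m}" "card (reverse_index m ` L) = n"
      by auto
    have sub: "submatrix X {0..<n} (reverse_index m ` L) \<in> carrier_mat n n"
      "submatrix Y (reverse_index m ` L) {0..<n} \<in> carrier_mat n n"
      by (simp_all add: submatrix_columns [OF L' X] submatrix_rows [OF L' Y])
    show "Op (row_det (submatrix X {0..<n} (reverse_index m ` L)) *
          row_det (submatrix Y (reverse_index m ` L) {0..<n})) =
        col_det (submatrix ?X {0..<n} L) * col_det (submatrix ?Y L {0..<n})"
      using Op.submatrix_antitranspose(1) [OF Y L'] Op.submatrix_antitranspose(2) [OF Y L' X]
      by (simp add: rr Op.col_det_antitranspose [OF sub(1)] Op.col_det_antitranspose [OF sub(2)] Op.mult)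
  qed
  finally show ?thesis
    by (simp add: Op_inject flip: Op.sum)
qed

section \<open>The parts (a), (b) and (c)\<close>

theorem proposition1p2:
  fixes X Y A B :: "'a::ring_1 mat" and n m :: nat
  assumes X: "X \<in> carrier_mat n m" and Y: "Y \<in> carrier_mat m n"
    and A: "A \<in> carrier_mat n n" and B: "B \<in> carrier_mat m m"
    and B_central: "\<forall>i<m. \<forall>j<m. \<forall>r::'a. commutator (B $$ (i,j)) r = 0"
    and XY: "\<forall>i<n. \<forall>j<m. \<forall>k<m. \<forall>l<n.
      commutator (X $$ (i,j)) (Y $$ (k,l)) = - (A $$ (i,l) * B $$ (k,j))"
  shows
    "(row_pseudo_commutative X \<and>
      (\<forall>i<n. \<forall>j<m. \<forall>k<n. \<forall>l<n.
         commutator (X $$ (i,j)) (A $$ (k,l)) - commutator (X $$ (k,j)) (A $$ (i,l)) = 0) \<longrightarrow>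
      (\<Sum>L | L \<subseteq> {0..<m} \<and> card L = n.
         col_det (submatrix X {0..<n} L) * col_det (submatrix Y L {0..<n}))
      = vac_expect (col_det (osc_matrix Ann Cre A B X Y)))
   \<and> (column_pseudo_commutative Y \<and>
      (\<forall>i<m. \<forall>j<n. \<forall>k<n. \<forall>l<n.
         commutator (Y $$ (i,j)) (A $$ (k,l)) - commutator (Y $$ (i,l)) (A $$ (k,j)) = 0) \<longrightarrow>
      (\<Sum>L | L \<subseteq> {0..<m} \<and> card L = n.
         row_det (submatrix X {0..<n} L) * row_det (submatrix Y L {0..<n}))
      = vac_expect (row_det (osc_matrix Cre Ann A B X Y)))
   \<and> ((\<forall>i<m. \<forall>j<n. \<forall>k<m. \<forall>l<n. j \<noteq> l \<longrightarrow> commutator (X $$ (j,i)) (X $$ (l,k)) = 0) \<and>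
      (\<forall>i<m. \<forall>j<n. \<forall>k<m. \<forall>l<n. j \<noteq> l \<longrightarrow> commutator (Y $$ (i,j)) (Y $$ (k,l)) = 0) \<and>
      (\<forall>i<n. \<forall>j<m. \<forall>k<n. \<forall>l<n.
         commutator (X $$ (i,j)) (A $$ (k,l)) - commutator (X $$ (k,j)) (A $$ (i,l)) = 0) \<and>
      (\<forall>i<m. \<forall>j<n. \<forall>k<n. \<forall>l<n.
         commutator (Y $$ (i,j)) (A $$ (k,l)) - commutator (Y $$ (i,l)) (A $$ (k,j)) = 0) \<longrightarrow>
      (\<Sum>L | L \<subseteq> {0..<m} \<and> card L = n.
         unordered_det (submatrix X {0..<n} L) * unordered_det (submatrix Y L {0..<n}))
      = vac_expect (col_det (osc_matrix Ann Cre A B X Y)) \<and>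
      vac_expect (col_det (osc_matrix Ann Cre A B X Y))
      = vac_expect (row_det (osc_matrix Cre Ann A B X Y)))"
proof (intro conjI impI; (elim conjE)?)
  have col: "(\<Sum>L | L \<subseteq> {0..<m} \<and> card L = n.
        col_det (submatrix X {0..<n} L) * col_det (submatrix Y L {0..<n}))
      = vac_expect (col_det (osc_matrix Ann Cre A B X Y))"
    if "row_pseudo_commutative X"
      and "\<forall>i<n. \<forall>j<m. \<forall>k<n. \<forall>l<n.
        commutator (X $$ (i,j)) (A $$ (k,l)) - commutator (X $$ (k,j)) (A $$ (i,l)) = 0"
    by (rule cauchy_binet_col_det [OF X Y A B]) (use that B_central XY in blast)+
  have row: "(\<Sum>L | L \<subseteq> {0..<m} \<and> card L = n.
        row_det (submatrix X {0..<n} L) * row_det (submatrix Y L {0..<n}))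
      = vac_expect (row_det (osc_matrix Cre Ann A B X Y))"
    if "column_pseudo_commutative Y"
      and "\<forall>i<m. \<forall>j<n. \<forall>k<n. \<forall>l<n.
        commutator (Y $$ (i,j)) (A $$ (k,l)) - commutator (Y $$ (i,l)) (A $$ (k,j)) = 0"
    by (rule cauchy_binet_row_det [OF X Y A B]) (use that B_central XY in blast)+
  {
    assume "row_pseudo_commutative X"
      and "\<forall>i<n. \<forall>j<m. \<forall>k<n. \<forall>l<n.
        commutator (X $$ (i,j)) (A $$ (k,l)) - commutator (X $$ (k,j)) (A $$ (i,l)) = 0"
    then show "(\<Sum>L | L \<subseteq> {0..<m} \<and> card L = n.
        col_det (submatrix X {0..<n} L) * col_det (submatrix Y L {0..<n}))
      = vac_expect (col_det (osc_matrix Ann Cre A B X Y))"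
      by (rule col)
  next
    assume "column_pseudo_commutative Y"
      and "\<forall>i<m. \<forall>j<n. \<forall>k<n. \<forall>l<n.
        commutator (Y $$ (i,j)) (A $$ (k,l)) - commutator (Y $$ (i,l)) (A $$ (k,j)) = 0"
    then show "(\<Sum>L | L \<subseteq> {0..<m} \<and> card L = n.
        row_det (submatrix X {0..<n} L) * row_det (submatrix Y L {0..<n}))
      = vac_expect (row_det (osc_matrix Cre Ann A B X Y))"
      by (rule row)
  next
    assume XX: "\<forall>i<m. \<forall>j<n. \<forall>k<m. \<forall>l<n. j \<noteq> l \<longrightarrow> commutator (X $$ (j,i)) (X $$ (l,k)) = 0"
      and YY: "\<forall>i<m. \<forall>j<n. \<forall>k<m. \<forall>l<n. j \<noteq> l \<longrightarrow> commutator (Y $$ (i,j)) (Y $$ (k,l)) = 0"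
      and XA: "\<forall>i<n. \<forall>j<m. \<forall>k<n. \<forall>l<n.
        commutator (X $$ (i,j)) (A $$ (k,l)) - commutator (X $$ (k,j)) (A $$ (i,l)) = 0"
      and YA: "\<forall>i<m. \<forall>j<n. \<forall>k<n. \<forall>l<n.
        commutator (Y $$ (i,j)) (A $$ (k,l)) - commutator (Y $$ (i,l)) (A $$ (k,j)) = 0"
    have self: "commutator x x = 0" for x :: 'a
      by (simp add: commutator_def)
    \<comment> \<open>Pseudo-commutativity holds by cases. For \<open>j \<noteq> l\<close> every
      commutator here vanishes; for \<open>j = l\<close> the two sides of the first relation
      coincide and the second is the commutator of an entry with itself.\<close>
    have "commutator (X $$ (j,i)) (X $$ (l,k)) = commutator (X $$ (l,i)) (X $$ (j,k))"
      and "commutator (X $$ (j,i)) (X $$ (l,i)) = 0"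
      if "i < m" "j < n" "k < m" "l < n" for i j k l
      using XX that self by (cases "j = l"; metis)+
    then have rpc: "row_pseudo_commutative X"
      unfolding row_pseudo_commutative_def column_pseudo_commutative_def
      by (auto simp: carrier_matD [OF X])
    have "commutator (Y $$ (i,j)) (Y $$ (k,l)) = commutator (Y $$ (i,l)) (Y $$ (k,j))"
      and "commutator (Y $$ (i,j)) (Y $$ (i,l)) = 0"
      if "i < m" "j < n" "k < m" "l < n" for i j k l
      using YY that self by (cases "j = l"; metis)+
    then have cpc: "column_pseudo_commutative Y"
      unfolding column_pseudo_commutative_def carrier_matD [OF Y] by blast
    have det: "unordered_det (submatrix X {0..<n} L) = row_det (submatrix X {0..<n} L)"
      "unordered_det (submatrix X {0..<n} L) = col_det (submatrix X {0..<n} L)"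
      "unordered_det (submatrix Y L {0..<n}) = row_det (submatrix Y L {0..<n})"
      "unordered_det (submatrix Y L {0..<n}) = col_det (submatrix Y L {0..<n})"
      if L: "L \<subseteq> {0..<m}" "card L = n" for L
    proof -
      have less: "sorted_list_of_set L ! j < m" if "j < n" for j
        using sorted_list_of_set_nth_less [OF L(1), of j] that L(2) by simp
      let ?X = "submatrix X {0..<n} L" and ?Y = "submatrix Y L {0..<n}"
      have sub: "?X \<in> carrier_mat n n" "?Y \<in> carrier_mat n n"
        by (simp_all add: submatrix_columns [OF L X] submatrix_rows [OF L Y])
      have comm_X: "commutator (?X $$ (i,j)) (?X $$ (k,l)) = 0"
        and comm_Y: "commutator (?Y $$ (i,j)) (?Y $$ (k,l)) = 0"
        if "i < n" "j < n" "k < n" "l < n" "i \<noteq> k" "j \<noteq> l" for i j k l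
        using that XX YY less by (simp_all add: submatrix_columns [OF L X] submatrix_rows [OF L Y])
      show "unordered_det ?X = row_det ?X" "unordered_det ?X = col_det ?X"
        using unordered_det_eq [OF sub(1)] comm_X by blast+
      show "unordered_det ?Y = row_det ?Y" "unordered_det ?Y = col_det ?Y"
        using unordered_det_eq [OF sub(2)] comm_Y by blast+
    qed
    have "(\<Sum>L | L \<subseteq> {0..<m} \<and> card L = n.
        unordered_det (submatrix X {0..<n} L) * unordered_det (submatrix Y L {0..<n})) =
      (\<Sum>L | L \<subseteq> {0..<m} \<and> card L = n.
        col_det (submatrix X {0..<n} L) * col_det (submatrix Y L {0..<n}))"
      by (rule sum.cong) (simp_all add: det(2,4))
    then show eq_col: "(\<Sum>L | L \<subseteq> {0..<m} \<and> card L = n.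
        unordered_det (submatrix X {0..<n} L) * unordered_det (submatrix Y L {0..<n}))
      = vac_expect (col_det (osc_matrix Ann Cre A B X Y))"
      using col [OF rpc XA] by simp
    have "(\<Sum>L | L \<subseteq> {0..<m} \<and> card L = n.
        unordered_det (submatrix X {0..<n} L) * unordered_det (submatrix Y L {0..<n})) =
      (\<Sum>L | L \<subseteq> {0..<m} \<and> card L = n.
        row_det (submatrix X {0..<n} L) * row_det (submatrix Y L {0..<n}))"
      by (rule sum.cong) (simp_all add: det(1,3))
    then show "vac_expect (col_det (osc_matrix Ann Cre A B X Y))
      = vac_expect (row_det (osc_matrix Cre Ann A B X Y))"
      using row [OF cpc YA] eq_col by simp
  }
qed

end
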